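(* Let $G$ be a bounded domain in $\mathbb{R}^n$, $n\ge2$, with Whitney decomposition $W$, let $1\le q\le p<\infty$ and $\delta,\tau\in(0,1)$. (1) If $q<p$ and there exists a chain decomposition of $G$ such that \[ \sum_{A\in W}\Bigg(\sum_{Q\in A(W)}\ell(\mathcal C(Q^* ))^{q-1}|Q|\,|A|^{q(\delta/n-1/p)}\Bigg)^{p/(p-q)}<\infty, \] then $G$ supports the fractional $(q,p)$-Poincaré inequality with parameters $\delta,\tau$. (2) If $q=p$ and there exists a chain decomposition of $G$ such that \[ \sup_{A\in W}\sum_{Q\in A(W)}\ell(\mathcal C(Q^* ))^{p-1}|Q|\,|A|^{p\delta/n-1}<\infty, \] then $G$ supports the fractional $(p,p)$-Poincaré inequality with parameters $\delta,\tau$.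
   Context: $W$ is a fixed Whitney decomposition of $G$: a family of closed dyadic cubes with pairwise disjoint interiors covering $G$ such that $\operatorname{diam}(Q)\le\operatorname{dist}(Q,\partial G)\le 4\operatorname{diam}(Q)$ for $Q\in W$. For $Q\in W$ write $Q^*=\tfrac98 Q$ (the cube with the same center and $9/8$ times the side length). A chain decomposition of $G$ with a fixed cube $Q_0\in W$: for each $Q\in W$ one chooses a chain $\mathcal C(Q^* )=(Q_0^*,Q_1^*,\dots,Q_k^* )$ with $Q_i\in W$, $Q_k=Q$, such that $Q_i^*\cap Q_j^*\ne\emptyset$ if and only if $|i-j|\le1$; its length is $\ell(\mathcal C(Q^* )):=k$. For $A\in W$, $A(W):=\{Q\in W: A^*\in\mathcal C(Q^* )\}$. $|E|$ is Lebesgue measure, $u_G$ the mean of $u$ over $G$. $G$ supports the fractional $(q,p)$-Poincaré inequality (with parameters $\delta,\tau\in(0,1)$) if there is $c<\infty$ such that for every $u\in L^p(G)$ \[ \int_G|u(x)-u_G|^q\,dx\le c\left(\int_G\int_{G\cap B^n(x,\tau\operatorname{dist}(x,\partial G))}\frac{|u(x)-u(y)|^p}{|x-y|^{n+\delta p}}\,dy\,dx\right)^{q/p}. \] *)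

theory Defs
  imports "HOL-Analysis.Analysis"
begin

definition dyadic_cube :: "(real^'n) set \<Rightarrow> bool" where
  "dyadic_cube Q \<longleftrightarrow> (\<exists>k::int. \<exists>a::real^'n. (\<forall>i. a $ i \<in> \<int>) \<and>
      Q = cbox ((2 powr k) *\<^sub>R a) ((2 powr k) *\<^sub>R (a + One)))"

definition cube_lo :: "(real^'n) set \<Rightarrow> real^'n" where
  "cube_lo Q = (\<chi> i. Inf ((\<lambda>x. x $ i) ` Q))"
definition cube_hi :: "(real^'n) set \<Rightarrow> real^'n" where
  "cube_hi Q = (\<chi> i. Sup ((\<lambda>x. x $ i) ` Q))"

text \<open>Q* = (9/8) Q: same center, 9/8 times the side length.\<close>
definition star :: "(real^'n) set \<Rightarrow> (real^'n) set" where
  "star Q = cbox (cube_lo Q - (1/16) *\<^sub>R (cube_hi Q - cube_lo Q))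
                 (cube_hi Q + (1/16) *\<^sub>R (cube_hi Q - cube_lo Q))"

definition whitney_decomposition :: "(real^'n) set \<Rightarrow> (real^'n) set set \<Rightarrow> bool" where
  "whitney_decomposition G W \<longleftrightarrow>
     (\<forall>Q\<in>W. dyadic_cube Q) \<and>
     (\<forall>Q\<in>W. \<forall>Q'\<in>W. Q \<noteq> Q' \<longrightarrow> interior Q \<inter> interior Q' = {}) \<and>
     \<Union>W = G \<and>
     (\<forall>Q\<in>W. diameter Q \<le> setdist Q (frontier G) \<and> setdist Q (frontier G) \<le> 4 * diameter Q)"

text \<open>A chain decomposition of G (w.r.t. W) with fixed cube Q0: C Q is the list of cubes
  (Q_0, ..., Q_k) in W, so that the chain C(Q*) is (Q_0*, ..., Q_k*).\<close>
definition chain_decomposition ::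
  "(real^'n) set set \<Rightarrow> (real^'n) set \<Rightarrow> ((real^'n) set \<Rightarrow> (real^'n) set list) \<Rightarrow> bool" where
  "chain_decomposition W Q0 C \<longleftrightarrow> Q0 \<in> W \<and>
     (\<forall>Q\<in>W. C Q \<noteq> [] \<and> hd (C Q) = Q0 \<and> last (C Q) = Q \<and> set (C Q) \<subseteq> W \<and>
        (\<forall>i<length (C Q). \<forall>j<length (C Q).
           (star (C Q ! i) \<inter> star (C Q ! j) \<noteq> {}) \<longleftrightarrow> \<bar>int i - int j\<bar> \<le> 1))"

text \<open>Length k of the chain (Q_0*, ..., Q_k*).\<close>
definition chain_length :: "(real^'n) set list \<Rightarrow> nat" where
  "chain_length cs = length cs - 1"

definition shadow :: "(real^'n) set set \<Rightarrow> ((real^'n) set \<Rightarrow> (real^'n) set list) \<Rightarrow> (real^'n) set \<Rightarrow> (real^'n) set set" where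
  "shadow W C A = {Q\<in>W. star A \<in> star ` set (C Q)}"

text \<open>Real power with the convention x^0 = 1 (also for x = 0), unlike Isabelle's powr.\<close>
definition pow0 :: "real \<Rightarrow> real \<Rightarrow> real" where
  "pow0 x a = (if a = 0 then 1 else x powr a)"

text \<open>Fractional (q,p)-Poincare inequality with parameters delta, tau.
  Integrals of nonnegative functions are taken in [0,\<infinity>]; when the right-hand double
  integral is infinite the inequality is trivial, so it is only required when it is finite.\<close>
definition fractional_poincare :: "(real^'n) set \<Rightarrow> real \<Rightarrow> real \<Rightarrow> real \<Rightarrow> real \<Rightarrow> bool" where
  "fractional_poincare G q p \<delta> \<tau> \<longleftrightarrow>
    (\<exists>c::real. \<forall>u :: real^'n \<Rightarrow> real.
       u \<in> borel_measurable (lebesgue_on G) \<longrightarrow>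
       integrable (lebesgue_on G) (\<lambda>x. \<bar>u x\<bar> powr p) \<longrightarrow>
       (let uG = (\<integral>x. u x \<partial>lebesgue_on G) / measure lebesgue G;
            D = (\<integral>\<^sup>+ x. (\<integral>\<^sup>+ y. ennreal (\<bar>u x - u y\<bar> powr p / dist x y powr (real CARD('n) + \<delta> * p))
                   \<partial>lebesgue_on (G \<inter> ball x (\<tau> * infdist x (frontier G)))) \<partial>lebesgue_on G)
        in D < \<infinity> \<longrightarrow>
           (\<integral>\<^sup>+ x. ennreal (\<bar>u x - uG\<bar> powr q) \<partial>lebesgue_on G)
             \<le> ennreal c * ennreal (enn2real D powr (q / p))))"

end

theory Submission
  imports Defs
begin

text \<open>
  On a cube Q of side s, an average of |u(x) - u(y)|^p over Q x Q is controlled by the part of the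
  fractional energy coming from x in Q, with the factor s^(\<delta>p - n): inserting the midpoint of
  x and y halves their distance, and after finitely many halvings y lies in the ball of radius
  \<tau> dist(x, \<partial>G). If Q* meets R*, then Q and R are comparable and, being dyadic, share a
  point z; shrinking both towards z makes all pairs admissible, so the means over Q and R differ by
  at most a constant times e(Q) + e(R), where e(A) = |A|^(\<delta>/n - 1/p) E(A)^(1/p) and E(A) is the
  energy of A. Telescoping along the chains, the power mean inequality and an exchange of the sums
  over Q and A bound the left-hand side by the sum over A of S(A) E(A)^(q/p), with S(A) the shadow
  sum of the hypothesis. As the E(A) add up to the full energy, Young's inequality (q < p) or the
  boundedness of S (q = p) finishes the proof.

  The function u is replaced by a Borel function that agrees with it almost everywhere, so that
  all integrals are taken with respect to the Borel-Lebesgue measure.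
\<close>

section \<open>Powers and means\<close>

text \<open>The Whitney condition gives only dist(x, \<partial>G) \<ge> diam(Q), while the energy
  sees only pairs with |x - y| < \<tau> dist(x, \<partial>G); for small \<tau> it may miss many
  pairs of a single cube. Halving needs the midpoint to stay in the set, hence convexity: it is
  available inside one cube but not on the union of two neighbours. This forces the detour through
  small cubes around z, which are so close to each other that the energy controls them without
  halving, while each is compared with its own large cube inside that cube. So the closed cubes
  themselves have to meet, and the dyadic positions turn the contact of the stars into such a
  contact. The energy enters asymmetrically, only x being tied to a cube, and therefore the local
  energies add up without overlap beyond null sets. The local constants must be uniform in the cube
  and in u; hence those lemmas quantify over functions and cubes inside the existential
  quantifier.\<close>

text \<open>Below \<mu> the first summand suffices, above it the second. With \<mu> at the size of
  an average, this one inequality serves in place of the Hoelder and Jensen inequalities, at the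
  cost of constant factors.\<close>

lemma le_add_powr:
  fixes t \<mu> p q :: real
  assumes "0 \<le> t" "0 < \<mu>" "0 \<le> q" "q \<le> p"
  shows "t powr q \<le> \<mu> powr q + \<mu> powr (q - p) * t powr p"
proof (cases "t \<le> \<mu>")
  case True
  then have "t powr q \<le> \<mu> powr q" using assms by (intro powr_mono2) auto
  then show ?thesis by (smt (verit) mult_nonneg_nonneg powr_ge_zero)
next
  case False
  then have "t powr (q - p) \<le> \<mu> powr (q - p)" using assms by (intro powr_mono2') auto
  then have "t powr (q - p) * t powr p \<le> \<mu> powr (q - p) * t powr p"
    by (intro mult_right_mono) auto
  moreover have "t powr (q - p) * t powr p = t powr q" by (simp flip: powr_add)
  ultimately show ?thesis by (smt (verit) powr_ge_zero)
qed

lemma powr_sum2_le: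
  fixes a b p :: real
  assumes "0 \<le> a" "0 \<le> b" "0 \<le> p"
  shows "(a + b) powr p \<le> 2 powr p * (a powr p + b powr p)"
proof -
  have "(a + b) powr p \<le> (2 * max a b) powr p" using assms by (intro powr_mono2) auto
  also have "\<dots> = 2 powr p * max a b powr p" using assms by (simp add: powr_mult)
  also have "\<dots> \<le> 2 powr p * (a powr p + b powr p)"
    by (intro mult_left_mono) (auto simp: max_def)
  finally show ?thesis .
qed

text \<open>The power mean inequality with a lossy factor 2 powr q. The number of terms enters
  through an upper bound \<open>N\<close>, so that a multiple of the chain length can take its
  place.\<close>

lemma sum_powr_le:
  fixes e :: "'a \<Rightarrow> real"
  assumes "finite S" "S \<noteq> {}" "\<And>i. i \<in> S \<Longrightarrow> 0 \<le> e i" "1 \<le> q" "real (card S) \<le> N"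
  shows "(\<Sum>i\<in>S. e i) powr q \<le> 2 powr q * N powr (q - 1) * (\<Sum>i\<in>S. e i powr q)"
proof (cases "(\<Sum>i\<in>S. e i) = 0")
  case True
  then show ?thesis using assms by (auto intro!: mult_nonneg_nonneg sum_nonneg)
next
  case False
  define T where "T = (\<Sum>i\<in>S. e i)"
  define \<mu> where "\<mu> = T / (2 * N)" \<comment> \<open>half of the average, so that the constant term is absorbed\<close>
  have T: "T > 0" unfolding T_def using False assms(3) sum_nonneg[of S e] by force
  have "card S \<ge> 1" using assms(1,2) by (simp add: Suc_leI card_gt_0_iff)
  then have N: "N > 0" using assms(5) by linarith
  have l: "\<mu> > 0" using T N by (simp add: \<mu>_def)
  have "T \<le> (\<Sum>i\<in>S. \<mu> + \<mu> powr (1 - q) * e i powr q)"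
    unfolding T_def
  proof (rule sum_mono)
    fix i assume "i \<in> S"
    then show "e i \<le> \<mu> + \<mu> powr (1 - q) * e i powr q"
      using le_add_powr[of "e i" \<mu> 1 q] l assms by auto
  qed
  also have "\<dots> = card S * \<mu> + \<mu> powr (1 - q) * (\<Sum>i\<in>S. e i powr q)"
    by (simp add: sum.distrib sum_distrib_left)
  also have "\<dots> \<le> N * \<mu> + \<mu> powr (1 - q) * (\<Sum>i\<in>S. e i powr q)"
    using assms(5) l by simp
  also have "N * \<mu> = T / 2" using N by (simp add: \<mu>_def)
  finally have *: "T / 2 \<le> \<mu> powr (1 - q) * (\<Sum>i\<in>S. e i powr q)" by simp
  have "\<mu> powr (q - 1) * (T / 2) \<le> \<mu> powr (q - 1) * (\<mu> powr (1 - q) * (\<Sum>i\<in>S. e i powr q))"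
    using * by (intro mult_left_mono) auto
  also have "\<dots> = (\<Sum>i\<in>S. e i powr q)"
    using l by (simp flip: mult.assoc powr_add)
  finally have **: "\<mu> powr (q - 1) * (T / 2) \<le> (\<Sum>i\<in>S. e i powr q)" .
  have "T powr q = 2 powr q * N powr (q - 1) * (\<mu> powr (q - 1) * (T / 2))"
    using T N by (simp add: \<mu>_def powr_divide powr_mult powr_diff)
  also have "\<dots> \<le> 2 powr q * N powr (q - 1) * (\<Sum>i\<in>S. e i powr q)"
    using ** by (intro mult_left_mono) auto
  finally show ?thesis by (simp add: T_def)
qed

text \<open>The two summands are equal exactly when S = E powr ((p - q) / p). On either side of this
  threshold one of them alone dominates the product, so no constants appear.\<close>

lemma Young_powr:
  fixes S E p q :: real
  assumes "0 \<le> S" "0 \<le> E" "0 < q" "q < p"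
  shows "S * E powr (q / p) \<le> S powr (p / (p - q)) + E"
proof (cases "S \<le> E powr ((p - q) / p)")
  case True
  then have "S * E powr (q / p) \<le> E powr ((p - q) / p) * E powr (q / p)"
    by (intro mult_right_mono) auto
  also have "\<dots> = E" using assms by (simp flip: powr_add add_divide_distrib)
  finally show ?thesis by (smt (verit) powr_ge_zero)
next
  case False
  have "(E powr ((p - q) / p)) powr (q / (p - q)) \<le> S powr (q / (p - q))"
    using False assms by (intro powr_mono2) auto
  then have "E powr (q / p) \<le> S powr (q / (p - q))"
    using assms by (simp add: powr_powr)
  then have "S * E powr (q / p) \<le> S * S powr (q / (p - q))"
    using assms by (intro mult_left_mono) auto
  also have "\<dots> = S powr (1 + q / (p - q))"
    using assms by (auto simp add: powr_add)
  also have "1 + q / (p - q) = p / (p - q)" using assms by (simp add: field_simps)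
  finally show ?thesis using assms by simp
qed

text \<open>Jensen's inequality up to the factor 2 powr p. If t is the deviation on the left, t |M|
  is at most the integral of |c - f|, and \<open>le_add_powr\<close> with \<mu> = t/2 bounds this by
  half of t |M| plus a multiple of the p-th power integral; the half is absorbed.\<close>

lemma mean_deviation_powr_le:
  fixes f :: "'a \<Rightarrow> real"
  assumes "finite_measure M" and pos: "0 < measure M (space M)" and f: "integrable M f" and p: "1 \<le> p"
  shows "ennreal (\<bar>c - (\<integral>x. f x \<partial>M) / measure M (space M)\<bar> powr p)
    \<le> ennreal (2 powr p / measure M (space M)) * (\<integral>\<^sup>+x. ennreal (\<bar>c - f x\<bar> powr p) \<partial>M)"
    (is "ennreal (\<bar>c - ?m\<bar> powr p) \<le> ennreal (_ / ?V) * ?J")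
proof (cases "?J = \<infinity> \<or> c = ?m")
  case True
  then show ?thesis
  proof
    assume "?J = \<infinity>"
    then show ?thesis using pos by (simp add: ennreal_mult_top)
  qed auto
next
  case False
  interpret finite_measure M by fact
  have [measurable]: "f \<in> borel_measurable M" using f by auto
  define t where "t = \<bar>c - ?m\<bar>"
  have t: "t > 0" using False by (simp add: t_def)
  obtain j where j: "j \<ge> 0" "?J = ennreal j"
    using False by (cases ?J) auto
  have "t * ?V = \<bar>\<integral>x. c - f x \<partial>M\<bar>"
    using f pos by (simp add: t_def Bochner_Integration.integral_diff abs_if field_simps)
  also have "\<dots> \<le> (\<integral>x. \<bar>c - f x\<bar> \<partial>M)"
    by (rule integral_abs_bound)
  finally have "ennreal (t * ?V) \<le> ennreal (\<integral>x. \<bar>c - f x\<bar> \<partial>M)"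
    by (rule ennreal_leI)
  also have "\<dots> = (\<integral>\<^sup>+x. ennreal \<bar>c - f x\<bar> \<partial>M)"
    using f by (intro nn_integral_eq_integral[symmetric]) auto
  also have "\<dots> \<le> (\<integral>\<^sup>+x. ennreal (t/2) + ennreal ((t/2) powr (1 - p)) * ennreal (\<bar>c - f x\<bar> powr p) \<partial>M)"
  proof (rule nn_integral_mono)
    fix x
    show "ennreal \<bar>c - f x\<bar> \<le> ennreal (t/2) + ennreal ((t/2) powr (1 - p)) * ennreal (\<bar>c - f x\<bar> powr p)"
      using le_add_powr[of "\<bar>c - f x\<bar>" "t/2" 1 p] t p
      by (simp flip: ennreal_mult ennreal_plus)
  qed
  also have "\<dots> = ennreal (t/2) * emeasure M (space M) + ennreal ((t/2) powr (1 - p)) * ?J"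
    by (subst nn_integral_add) (auto simp: nn_integral_cmult)
  also have "\<dots> = ennreal (t/2 * ?V + (t/2) powr (1 - p) * j)"
    using t j by (simp add: emeasure_eq_measure flip: ennreal_mult ennreal_plus)
  finally have "t * ?V \<le> t/2 * ?V + (t/2) powr (1 - p) * j"
    using t j by (subst (asm) ennreal_le_iff) auto
  then have "t/2 * ?V \<le> (t/2) powr (1 - p) * j" by simp
  then have "(t/2) powr (p - 1) * (t/2 * ?V) \<le> (t/2) powr (p - 1) * ((t/2) powr (1 - p) * j)"
    by (intro mult_left_mono) auto
  also have "\<dots> = j" using t by (simp flip: mult.assoc powr_add)
  also have "(t/2) powr (p - 1) * (t/2 * ?V) = (t/2) powr p * ?V"
    using t by (simp add: powr_diff)
  finally have "(t/2) powr p * ?V \<le> j" .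
  then have "t powr p \<le> 2 powr p / ?V * j"
    using pos t by (simp add: powr_divide field_simps)
  then show ?thesis
    using j pos by (simp add: t_def flip: ennreal_mult)
qed

text \<open>Stands in for Hoelder's inequality between the exponents p and q: \<mu> bounds the
  p-mean of f, and integrating \<open>le_add_powr\<close> yields two terms of at most V \<mu> powr q
  each. For \<mu> = 0 the function vanishes almost everywhere.\<close>

lemma nn_integral_powr_exponent_le:
  fixes f :: "'a \<Rightarrow> real"
  assumes [measurable]: "f \<in> borel_measurable M" and nn: "\<And>x. 0 \<le> f x" and qp: "1 \<le> q" "q \<le> p"
    and V: "emeasure M (space M) = ennreal V" "0 \<le> V" and l: "0 \<le> \<mu>"
    and le: "(\<integral>\<^sup>+x. ennreal (f x powr p) \<partial>M) \<le> ennreal (V * \<mu> powr p)"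
  shows "(\<integral>\<^sup>+x. ennreal (f x powr q) \<partial>M) \<le> ennreal (2 * V * \<mu> powr q)"
proof (cases "\<mu> = 0")
  case True
  then have "(\<integral>\<^sup>+x. ennreal (f x powr p) \<partial>M) = 0" using le by simp
  then have "AE x in M. f x = 0"
    by (simp add: nn_integral_0_iff_AE)
  then have "(\<integral>\<^sup>+x. ennreal (f x powr q) \<partial>M) = 0"
    by (simp add: nn_integral_0_iff_AE)
  then show ?thesis by simp
next
  case False
  then have l: "\<mu> > 0" using l by simp
  have "(\<integral>\<^sup>+x. ennreal (f x powr q) \<partial>M)
      \<le> (\<integral>\<^sup>+x. ennreal (\<mu> powr q) + ennreal (\<mu> powr (q - p)) * ennreal (f x powr p) \<partial>M)"
  proof (rule nn_integral_mono)
    fix x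
    show "ennreal (f x powr q) \<le> ennreal (\<mu> powr q) + ennreal (\<mu> powr (q - p)) * ennreal (f x powr p)"
      using le_add_powr[of "f x" \<mu> q p] l nn qp by (simp flip: ennreal_mult ennreal_plus)
  qed
  also have "\<dots> = ennreal (\<mu> powr q) * ennreal V + ennreal (\<mu> powr (q - p)) * (\<integral>\<^sup>+x. ennreal (f x powr p) \<partial>M)"
    by (subst nn_integral_add) (auto simp: nn_integral_cmult V)
  also have "\<dots> \<le> ennreal (\<mu> powr q) * ennreal V + ennreal (\<mu> powr (q - p)) * ennreal (V * \<mu> powr p)"
    by (intro add_left_mono mult_left_mono le) auto
  also have "\<dots> = ennreal (\<mu> powr q * V + \<mu> powr (q - p) * (V * \<mu> powr p))"
    using V by (simp flip: ennreal_mult ennreal_plus)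
  also have "\<mu> powr (q - p) * (V * \<mu> powr p) = V * \<mu> powr q"
    by (simp add: algebra_simps flip: powr_add)
  finally show ?thesis by (simp add: algebra_simps)
qed

section \<open>Oscillation and energy\<close>

text \<open>Substitute y = 2m - x, whose Jacobian is 2 ^ DIM. The integral runs over the whole
  space, so every restriction on the midpoint has to be part of f.\<close>

lemma nn_integral_lborel_midpoint:
  fixes f :: "'a::euclidean_space \<Rightarrow> ennreal"
  assumes [measurable]: "f \<in> borel_measurable borel"
  shows "(\<integral>\<^sup>+y. f ((1/2) *\<^sub>R (x + y)) \<partial>lborel) = 2 ^ DIM('a) * (\<integral>\<^sup>+y. f y \<partial>lborel)"
proof -
  have "(\<integral>\<^sup>+y. f ((1/2) *\<^sub>R (x + y)) \<partial>lborel)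
      = (\<integral>\<^sup>+y. f ((1/2) *\<^sub>R (x + y)) \<partial>(density (distr lborel borel (\<lambda>m. - x + 2 *\<^sub>R m)) (\<lambda>_. \<bar>2::real\<bar>^DIM('a))))"
    by (rule arg_cong[where f="\<lambda>M. nn_integral M _"], rule lborel_affine) simp
  also have "\<dots> = (\<integral>\<^sup>+m. 2 ^ DIM('a) * f m \<partial>lborel)"
    by (simp add: nn_integral_density nn_integral_distr flip: ennreal_power)
  finally show ?thesis by (simp add: nn_integral_cmult)
qed

text \<open>The restrictions to S, T and distance at most r sit in the integrand, so that joint
  measurability is immediate and the midpoint substitution and Fubini apply on the whole
  space.\<close>

definition osc_kernel :: "real \<Rightarrow> ('a::metric_space \<Rightarrow> real) \<Rightarrow> 'a set \<Rightarrow> 'a set \<Rightarrow> real \<Rightarrow> 'a \<Rightarrow> 'a \<Rightarrow> ennreal" where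
  "osc_kernel p v S T r x y =
     (if x \<in> S \<and> y \<in> T \<and> dist x y \<le> r then ennreal (\<bar>v x - v y\<bar> powr p) else 0)"

definition oscillation :: "real \<Rightarrow> ('a::euclidean_space \<Rightarrow> real) \<Rightarrow> 'a set \<Rightarrow> 'a set \<Rightarrow> real \<Rightarrow> ennreal" where
  "oscillation p v S T r = (\<integral>\<^sup>+x. \<integral>\<^sup>+y. osc_kernel p v S T r x y \<partial>lborel \<partial>lborel)"

lemma osc_kernel_measurable [measurable]:
  fixes v :: "'a::euclidean_space \<Rightarrow> real"
  assumes [measurable]: "v \<in> borel_measurable borel" "S \<in> sets borel" "T \<in> sets borel"
    and [measurable]: "f \<in> borel_measurable M" "g \<in> borel_measurable M"
  shows "(\<lambda>w. osc_kernel p v S T r (f w) (g w)) \<in> borel_measurable M"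
  unfolding osc_kernel_def by measurable

lemma oscillation_mono:
  assumes "S \<subseteq> S'" "T \<subseteq> T'" "r \<le> r'"
  shows "oscillation p v S T r \<le> oscillation p v S' T' r'"
  unfolding oscillation_def osc_kernel_def
  by (intro nn_integral_mono) (use assms in auto)

text \<open>Through the midpoint m the pair (x, y) is replaced by (x, m) and (y, m) at half the
  distance, and convexity keeps m in \<open>A\<close>. The factors are 2 powr p from splitting the
  power, 2 from the two pairs and 2 ^ DIM from the substitution.\<close>

lemma oscillation_halve:
  fixes v :: "'a::euclidean_space \<Rightarrow> real"
  assumes [measurable]: "v \<in> borel_measurable borel" "A \<in> sets borel" and A: "convex A" and p: "0 \<le> p"
  shows "oscillation p v A A r \<le> ennreal (2 powr p * 2 * 2 ^ DIM('a)) * oscillation p v A A (r / 2)"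
proof -
  let ?k = "osc_kernel p v A A"
  let ?m = "\<lambda>x y. (1/2::real) *\<^sub>R (x + y)"
  have le: "?k r x y \<le> ennreal (2 powr p) * (?k (r/2) x (?m x y) + ?k (r/2) y (?m y x))" for x y
  proof (cases "x \<in> A \<and> y \<in> A \<and> dist x y \<le> r")
    case True
    have m: "?m x y \<in> A" using True convexD[OF A, of x y "1/2" "1/2"] by (simp add: scaleR_add_right)
    have "x - ?m x y = (1/2) *\<^sub>R (x - y)" "y - ?m x y = (1/2) *\<^sub>R (y - x)"
      by (simp_all add: algebra_simps flip: scaleR_add_left)
    then have d: "dist x (?m x y) \<le> r/2" "dist y (?m x y) \<le> r/2"
      using True by (simp_all add: dist_norm norm_minus_commute)
    have "\<bar>v x - v y\<bar> powr p \<le> (\<bar>v x - v (?m x y)\<bar> + \<bar>v y - v (?m x y)\<bar>) powr p"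
      using p by (intro powr_mono2) auto
    also have "\<dots> \<le> 2 powr p * (\<bar>v x - v (?m x y)\<bar> powr p + \<bar>v y - v (?m x y)\<bar> powr p)"
      by (rule powr_sum2_le) (use p in auto)
    finally show ?thesis
      using True m d unfolding osc_kernel_def
      by (simp add: add.commute[of y x] flip: ennreal_mult ennreal_plus)
  qed (auto simp: osc_kernel_def)
  have sub: "(\<integral>\<^sup>+x. \<integral>\<^sup>+y. ?k (r/2) x (?m x y) \<partial>lborel \<partial>lborel) = 2 ^ DIM('a) * oscillation p v A A (r / 2)"
    unfolding oscillation_def
    by (subst nn_integral_lborel_midpoint) (auto simp: nn_integral_cmult)
  have "oscillation p v A A r \<le> (\<integral>\<^sup>+x. \<integral>\<^sup>+y. ennreal (2 powr p) * (?k (r/2) x (?m x y) + ?k (r/2) y (?m y x)) \<partial>lborel \<partial>lborel)"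
    unfolding oscillation_def by (intro nn_integral_mono le)
  also have "\<dots> = ennreal (2 powr p) * ((\<integral>\<^sup>+x. \<integral>\<^sup>+y. ?k (r/2) x (?m x y) \<partial>lborel \<partial>lborel)
      + (\<integral>\<^sup>+x. \<integral>\<^sup>+y. ?k (r/2) y (?m y x) \<partial>lborel \<partial>lborel))"
    by (simp add: nn_integral_cmult nn_integral_add)
  \<comment> \<open>Exchanging the order of integration and renaming, the second pair contributes as
    much as the first.\<close>
  also have "(\<integral>\<^sup>+x. \<integral>\<^sup>+y. ?k (r/2) y (?m y x) \<partial>lborel \<partial>lborel) = (\<integral>\<^sup>+x. \<integral>\<^sup>+y. ?k (r/2) x (?m x y) \<partial>lborel \<partial>lborel)"
    by (rule lborel_pair.Fubini') measurable
  also have "ennreal (2 powr p) * ((\<integral>\<^sup>+x. \<integral>\<^sup>+y. ?k (r/2) x (?m x y) \<partial>lborel \<partial>lborel)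
      + (\<integral>\<^sup>+x. \<integral>\<^sup>+y. ?k (r/2) x (?m x y) \<partial>lborel \<partial>lborel))
    = ennreal (2 powr p * 2 * 2 ^ DIM('a)) * oscillation p v A A (r / 2)"
    unfolding sub mult_2[symmetric]
    by (simp only: ennreal_mult ennreal_power[symmetric] ennreal_numeral mult.assoc powr_ge_zero
        zero_le_numeral zero_le_power mult_nonneg_nonneg)
  finally show ?thesis .
qed

lemma oscillation_halve_iterated:
  fixes v :: "'a::euclidean_space \<Rightarrow> real"
  assumes "v \<in> borel_measurable borel" "A \<in> sets borel" "convex A" "0 \<le> p"
  shows "oscillation p v A A r \<le> ennreal ((2 powr p * 2 * 2 ^ DIM('a)) ^ k) * oscillation p v A A (r / 2 ^ k)"
proof (induction k)
  case (Suc k)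
  have "oscillation p v A A (r / 2 ^ k) \<le> ennreal (2 powr p * 2 * 2 ^ DIM('a)) * oscillation p v A A (r / 2 ^ k / 2)"
    by (rule oscillation_halve) fact+
  then have "oscillation p v A A r \<le> ennreal ((2 powr p * 2 * 2 ^ DIM('a)) ^ k) *
      (ennreal (2 powr p * 2 * 2 ^ DIM('a)) * oscillation p v A A (r / 2 ^ k / 2))"
    by (intro order_trans[OF Suc] mult_left_mono) auto
  also have "\<dots> = ennreal ((2 powr p * 2 * 2 ^ DIM('a)) ^ Suc k) * oscillation p v A A (r / 2 ^ Suc k)"
    by (simp only: mult.assoc[symmetric] ennreal_mult[symmetric] power_Suc2 powr_ge_zero
        zero_le_numeral zero_le_power mult_nonneg_nonneg divide_divide_eq_left)
  finally show ?case .
qed simp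

section \<open>The fractional energy and its local parts\<close>

definition gagliardo :: "'a::euclidean_space set \<Rightarrow> real \<Rightarrow> real \<Rightarrow> real \<Rightarrow> ('a \<Rightarrow> real) \<Rightarrow> 'a \<Rightarrow> ennreal" where
  "gagliardo G \<tau> s p v x = (\<integral>\<^sup>+y. ennreal (\<bar>v x - v y\<bar> powr p / dist x y powr s)
      * indicator (G \<inter> ball x (\<tau> * infdist x (frontier G))) y \<partial>lborel)"

lemma gagliardo_measurable [measurable]:
  fixes G :: "'a::euclidean_space set"
  assumes [measurable]: "v \<in> borel_measurable borel" "G \<in> sets borel"
  shows "gagliardo G \<tau> s p v \<in> borel_measurable borel"
proof -
  have [measurable]: "(\<lambda>x. infdist x (frontier G)) \<in> borel_measurable borel"
    by (intro borel_measurable_continuous_onI continuous_intros)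
  \<comment> \<open>The domain of integration depends on x; as a condition on the pair (x, y) it
    becomes jointly measurable.\<close>
  have eq: "gagliardo G \<tau> s p v x = (\<integral>\<^sup>+y. (if y \<in> G \<and> dist x y < \<tau> * infdist x (frontier G)
      then ennreal (\<bar>v x - v y\<bar> powr p / dist x y powr s) else 0) \<partial>lborel)" for x
    unfolding gagliardo_def by (intro nn_integral_cong) (auto simp: indicator_def)
  show ?thesis unfolding eq by measurable
qed

definition energy :: "'a::euclidean_space set \<Rightarrow> real \<Rightarrow> real \<Rightarrow> real \<Rightarrow> ('a \<Rightarrow> real) \<Rightarrow> 'a set \<Rightarrow> ennreal" where
  "energy G \<tau> s p v S = (\<integral>\<^sup>+x. gagliardo G \<tau> s p v x * indicator S x \<partial>lborel)"

lemma energy_mono: "S \<subseteq> T \<Longrightarrow> energy G \<tau> s p v S \<le> energy G \<tau> s p v T"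
  unfolding energy_def by (intro nn_integral_mono) (auto simp: indicator_def)

text \<open>Pairs at distance at most \<rho> carry the weight |x - y|^(-s) \<ge> \<rho>^(-s) in the
  energy. Only the points of S need large balls, while T is merely a part of G; this is why the
  energy of S alone appears.\<close>

lemma oscillation_le_energy:
  fixes G :: "'a::euclidean_space set"
  assumes [measurable]: "v \<in> borel_measurable borel" "G \<in> sets borel" "S \<in> sets borel" "T \<in> sets borel"
    and "T \<subseteq> G" "0 \<le> s" "0 < p" and near: "\<And>x. x \<in> S \<Longrightarrow> \<rho> < \<tau> * infdist x (frontier G)"
  shows "oscillation p v S T \<rho> \<le> ennreal (\<rho> powr s) * energy G \<tau> s p v S"
proof -
  let ?B = "\<lambda>x. G \<inter> ball x (\<tau> * infdist x (frontier G))"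
  have pt: "osc_kernel p v S T \<rho> x y \<le> ennreal (\<rho> powr s) *
      (ennreal (\<bar>v x - v y\<bar> powr p / dist x y powr s) * indicator (?B x) y)"
    if "x \<in> S" for x y
  \<comment> \<open>On the diagonal one cannot divide by the distance; there the kernel is
    0.\<close>
  proof (cases "y \<in> T \<and> dist x y \<le> \<rho> \<and> x \<noteq> y")
    case True
    then have y: "y \<in> ?B x" using that near[of x] assms(5) by auto
    have d: "dist x y > 0" using True by simp
    have "\<bar>v x - v y\<bar> powr p * dist x y powr s \<le> \<bar>v x - v y\<bar> powr p * \<rho> powr s"
      using True assms(6) by (intro mult_left_mono powr_mono2) auto
    then have "\<bar>v x - v y\<bar> powr p \<le> \<rho> powr s * (\<bar>v x - v y\<bar> powr p / dist x y powr s)"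
      using d by (simp add: field_simps)
    then show ?thesis
      using True that y by (simp add: osc_kernel_def flip: ennreal_mult)
  qed (use assms(7) in \<open>auto simp: osc_kernel_def\<close>)
  have "(\<integral>\<^sup>+y. osc_kernel p v S T \<rho> x y \<partial>lborel) \<le> ennreal (\<rho> powr s) * (gagliardo G \<tau> s p v x * indicator S x)" for x
  proof (cases "x \<in> S")
    case True
    have "?B x \<in> sets borel" by simp
    have "(\<integral>\<^sup>+y. osc_kernel p v S T \<rho> x y \<partial>lborel) \<le> (\<integral>\<^sup>+y. ennreal (\<rho> powr s) *
      (ennreal (\<bar>v x - v y\<bar> powr p / dist x y powr s) * indicator (?B x) y) \<partial>lborel)"
      by (intro nn_integral_mono pt True)
    also have "\<dots> = ennreal (\<rho> powr s) * gagliardo G \<tau> s p v x"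
      unfolding gagliardo_def by (rule nn_integral_cmult) (use \<open>?B x \<in> sets borel\<close> in measurable)
    finally show ?thesis using True by simp
  qed (simp add: osc_kernel_def)
  then have "oscillation p v S T \<rho> \<le> (\<integral>\<^sup>+x. ennreal (\<rho> powr s) * (gagliardo G \<tau> s p v x * indicator S x) \<partial>lborel)"
    unfolding oscillation_def by (intro nn_integral_mono)
  also have "\<dots> = ennreal (\<rho> powr s) * energy G \<tau> s p v S"
    unfolding energy_def by (rule nn_integral_cmult) measurable
  finally show ?thesis .
qed

section \<open>Mean values and oscillation\<close>

definition mean :: "'a::euclidean_space set \<Rightarrow> ('a \<Rightarrow> real) \<Rightarrow> real" where
  "mean S v = (LINT x:S|lborel. v x) / measure lborel S"

lemma mean_deviation_set:
  fixes v :: "'a::euclidean_space \<Rightarrow> real"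
  assumes [measurable]: "S \<in> sets borel" and "emeasure lborel S < \<infinity>" "0 < measure lborel S"
    and "set_integrable lborel S v" and "1 \<le> p"
  shows "ennreal (\<bar>c - mean S v\<bar> powr p)
    \<le> ennreal (2 powr p / measure lborel S) * (\<integral>\<^sup>+x. ennreal (\<bar>c - v x\<bar> powr p) * indicator S x \<partial>lborel)"
proof -
  let ?M = "restrict_space lborel S"
  have "finite_measure ?M"
    by standard (use assms in \<open>simp add: emeasure_restrict_space\<close>)
  moreover have m: "measure ?M (space ?M) = measure lborel S"
    by (simp add: measure_restrict_space)
  moreover have "integrable ?M v"
    using assms by (simp add: integrable_restrict_space set_integrable_def)
  moreover have "(\<integral>x. v x \<partial>?M) = (LINT x:S|lborel. v x)"
    by (simp add: integral_restrict_space set_lebesgue_integral_def)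
  moreover have "(\<integral>\<^sup>+x. ennreal (\<bar>c - v x\<bar> powr p) \<partial>?M) = (\<integral>\<^sup>+x. ennreal (\<bar>c - v x\<bar> powr p) * indicator S x \<partial>lborel)"
    by (simp add: nn_integral_restrict_space)
  ultimately show ?thesis
    using mean_deviation_powr_le[of ?M v p c] assms by (simp add: mean_def)
qed

text \<open>Integrate \<open>mean_deviation_set\<close> with the constant c = v x over x in S. Since
  r bounds all distances between S and T, the cut-off in the kernel is inactive.\<close>

lemma mean_deviation_oscillation:
  fixes v :: "'a::euclidean_space \<Rightarrow> real"
  assumes [measurable]: "v \<in> borel_measurable borel" "S \<in> sets borel" "T \<in> sets borel"
    and "emeasure lborel T < \<infinity>" "0 < measure lborel T" "set_integrable lborel T v" "1 \<le> p"
    and r: "\<And>x y. x \<in> S \<Longrightarrow> y \<in> T \<Longrightarrow> dist x y \<le> r"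
  shows "(\<integral>\<^sup>+x. ennreal (\<bar>v x - mean T v\<bar> powr p) * indicator S x \<partial>lborel)
    \<le> ennreal (2 powr p / measure lborel T) * oscillation p v S T r"
proof -
  have "(\<integral>\<^sup>+x. ennreal (\<bar>v x - mean T v\<bar> powr p) * indicator S x \<partial>lborel)
    \<le> (\<integral>\<^sup>+x. ennreal (2 powr p / measure lborel T) * (\<integral>\<^sup>+y. osc_kernel p v S T r x y \<partial>lborel) \<partial>lborel)"
  proof (rule nn_integral_mono)
    fix x
    have "(\<integral>\<^sup>+y. ennreal (\<bar>v x - v y\<bar> powr p) * indicator T y \<partial>lborel) = (\<integral>\<^sup>+y. osc_kernel p v S T r x y \<partial>lborel)"
      if "x \<in> S"
      by (intro nn_integral_cong) (use r that in \<open>auto simp: osc_kernel_def indicator_def\<close>)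
    then show "ennreal (\<bar>v x - mean T v\<bar> powr p) * indicator S x
        \<le> ennreal (2 powr p / measure lborel T) * (\<integral>\<^sup>+y. osc_kernel p v S T r x y \<partial>lborel)"
      using mean_deviation_set[of T v p "v x"] assms by (auto simp: indicator_def)
  qed
  also have "\<dots> = ennreal (2 powr p / measure lborel T) * oscillation p v S T r"
    unfolding oscillation_def by (rule nn_integral_cmult) measurable
  finally show ?thesis .
qed

text \<open>The deviation estimate is used twice, first on S with the constant
  \<open>mean T v\<close>, then on T; hence 4 powr p and both volumes.\<close>

lemma mean_diff_oscillation:
  fixes v :: "'a::euclidean_space \<Rightarrow> real"
  assumes [measurable]: "v \<in> borel_measurable borel" "S \<in> sets borel" "T \<in> sets borel"
    and "emeasure lborel S < \<infinity>" "0 < measure lborel S" "set_integrable lborel S v"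
    and "emeasure lborel T < \<infinity>" "0 < measure lborel T" "set_integrable lborel T v" and p: "1 \<le> p"
    and r: "\<And>x y. x \<in> S \<Longrightarrow> y \<in> T \<Longrightarrow> dist x y \<le> r"
  shows "ennreal (\<bar>mean S v - mean T v\<bar> powr p)
    \<le> ennreal (4 powr p / (measure lborel S * measure lborel T)) * oscillation p v S T r"
proof -
  have "ennreal (\<bar>mean S v - mean T v\<bar> powr p) = ennreal (\<bar>mean T v - mean S v\<bar> powr p)"
    by (simp add: abs_minus_commute)
  also have "\<dots> \<le> ennreal (2 powr p / measure lborel S)
      * (\<integral>\<^sup>+x. ennreal (\<bar>mean T v - v x\<bar> powr p) * indicator S x \<partial>lborel)"
    by (rule mean_deviation_set) (use assms in auto)
  also have "\<dots> = ennreal (2 powr p / measure lborel S)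
      * (\<integral>\<^sup>+x. ennreal (\<bar>v x - mean T v\<bar> powr p) * indicator S x \<partial>lborel)"
    by (simp add: abs_minus_commute)
  also have "\<dots> \<le> ennreal (2 powr p / measure lborel S) * (ennreal (2 powr p / measure lborel T) * oscillation p v S T r)"
    by (intro mult_left_mono mean_deviation_oscillation) (use assms in auto)
  also have "\<dots> = ennreal ((2 powr p / measure lborel S) * (2 powr p / measure lborel T)) * oscillation p v S T r"
    by (simp only: ennreal_mult mult.assoc powr_ge_zero divide_nonneg_nonneg measure_nonneg)
  also have "(2 powr p / measure lborel S) * (2 powr p / measure lborel T) = 4 powr p / (measure lborel S * measure lborel T)"
    by (simp flip: powr_mult)
  finally show ?thesis .
qed

section \<open>Whitney cubes\<close>

definition cube :: "real^'n \<Rightarrow> real \<Rightarrow> (real^'n) set" where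
  "cube a s = cbox a (a + s *\<^sub>R 1)"

abbreviation diag :: "'n::finite itself \<Rightarrow> real" where
  "diag _ \<equiv> norm (1 :: real^'n)"

lemma One_eq_1: "(One :: real^'n) = 1"
proof -
  have "(One :: real^'n) $ i = 1" for i
    unfolding cart_eq_inner_axis by (simp add: inner_Basis inner_sum_left axis_in_Basis_iff del: sum_component)
  then show ?thesis by (simp add: vec_eq_iff del: sum_component)
qed

lemma diag_pos: "0 < diag TYPE('n::finite)"
  by simp

lemma mem_cube: "x \<in> cube a s \<longleftrightarrow> (\<forall>i. a $ i \<le> x $ i \<and> x $ i \<le> a $ i + s)"
  by (simp add: cube_def mem_box_cart)

lemma cube_borel [measurable, simp]: "cube a s \<in> sets borel"
  by (simp add: cube_def)

lemma convex_cube: "convex (cube a s)"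
  by (simp add: cube_def)

lemma compact_cube: "compact (cube a s)"
  by (simp add: cube_def compact_cbox)

lemma measure_cube: "0 \<le> s \<Longrightarrow> measure lborel (cube (a :: real^'n) s) = s ^ CARD('n)"
  unfolding cube_def by (subst content_cbox_cart) (auto simp: interval_ne_empty_cart)

lemma emeasure_cube_finite: "emeasure lborel (cube a s) < \<infinity>"
  unfolding cube_def by (rule emeasure_lborel_cbox_finite)

lemma dist_le_diag:
  assumes "\<And>i. \<bar>x $ i - y $ i\<bar> \<le> r" "0 \<le> r"
  shows "dist x (y :: real^'n) \<le> r * diag TYPE('n)"
proof -
  have "norm (x - y) \<le> norm (r *\<^sub>R (1 :: real^'n))"
    by (rule norm_le_componentwise_cart) (use assms in auto)
  then show ?thesis using assms by (simp add: dist_norm)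
qed

lemma cube_dist_le:
  assumes "x \<in> cube a s" "y \<in> cube (a :: real^'n) s"
  shows "dist x y \<le> s * diag TYPE('n)"
proof (rule dist_le_diag)
  fix i
  show "\<bar>x $ i - y $ i\<bar> \<le> s" using assms unfolding mem_cube by (auto simp: abs_le_iff dest!: spec[of _ i])
  then show "0 \<le> s" by linarith
qed

lemma diameter_cube: "0 \<le> s \<Longrightarrow> diameter (cube (a :: real^'n) s) = s * diag TYPE('n)"
  unfolding cube_def
  by (subst diameter_cbox) (auto simp: dist_norm inner_add_left inner_sum_left_Basis simp flip: One_eq_1)

lemma cube_lo_hi:
  assumes "0 \<le> s"
  shows "cube_lo (cube a s) = a" "cube_hi (cube a s) = a + s *\<^sub>R 1"
proof -
  have "Inf ((\<lambda>x. x $ i) ` cube a s) = a $ i" for i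
    by (rule cInf_eq_minimum) (use assms in \<open>auto simp: mem_cube intro!: image_eqI[of _ _ a]\<close>)
  then show "cube_lo (cube a s) = a" by (simp add: cube_lo_def vec_eq_iff)
  have "Sup ((\<lambda>x. x $ i) ` cube a s) = (a + s *\<^sub>R 1) $ i" for i
    by (rule cSup_eq_maximum) (use assms in \<open>auto simp: mem_cube intro!: image_eqI[of _ _ "a + s *\<^sub>R 1"]\<close>)
  then show "cube_hi (cube a s) = a + s *\<^sub>R 1" by (simp add: cube_hi_def vec_eq_iff)
qed

lemma mem_star_cube:
  assumes "0 \<le> s"
  shows "x \<in> star (cube a s) \<longleftrightarrow> (\<forall>i. a $ i - s/16 \<le> x $ i \<and> x $ i \<le> a $ i + s + s/16)"
  by (simp add: star_def cube_lo_hi assms mem_box_cart algebra_simps)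

lemma star_cube_near:
  assumes "0 \<le> s" "z \<in> star (cube (a :: real^'n) s)"
  obtains x where "x \<in> cube a s" "dist x z \<le> s/16 * diag TYPE('n)"
proof
  \<comment> \<open>The nearest point of the cube, obtained by clamping every coordinate of
    z.\<close>
  define x :: "real^'n" where "x = (\<chi> i. max (a $ i) (min (z $ i) (a $ i + s)))"
  show "x \<in> cube a s" using assms(1) by (auto simp: mem_cube x_def)
  show "dist x z \<le> s/16 * diag TYPE('n)"
  proof (rule dist_le_diag)
    fix i
    have "a $ i - s/16 \<le> z $ i" "z $ i \<le> a $ i + s + s/16"
      using assms by (simp_all add: mem_star_cube)
    then show "\<bar>x $ i - z $ i\<bar> \<le> s/16" using assms(1) by (auto simp: x_def max_def min_def abs_if)
  qed (use assms in simp)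
qed

text \<open>Both endpoints are integer multiples of the smaller side t, so a gap would be at least t, more
  than the enlargement by (s + t)/16 can bridge.\<close>

lemma dyadic_interval_touch:
  fixes k j m l :: int and z s t :: real
  assumes s_def: "s = 2 powr k" and t_def: "t = 2 powr j" and kj: "j \<le> k" and le: "s \<le> 6 * t"
    and z: "s * m - s/16 \<le> z" "z \<le> s * m + s + s/16" "t * l - t/16 \<le> z" "z \<le> t * l + t + t/16"
  shows "s * m \<le> t * l + t" "t * l \<le> s * m + s"
proof -
  define S :: int where "S = 2 ^ nat (k - j)"
  have t: "t > 0" by (simp add: t_def)
  have "s = t * 2 powr (real (nat (k - j)))"
    using kj by (simp add: s_def t_def flip: powr_add)
  then have s: "s = t * S" by (simp add: S_def powr_realpow)
  \<comment> \<open>The gap is at most (s + t)/16 \<le> 7t/16 because s \<le> 6t, and an integer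
    multiple of t that is below t is at most 0.\<close>
  have "t * (S * m - l - 1) < t * 1"
  proof -
    have "t * (S * m - l - 1) = s * m - t * l - t" by (simp add: s algebra_simps)
    also have "\<dots> < t" using z le t by linarith
    finally show ?thesis by simp
  qed
  then have "S * m - l - 1 < (1::real)" using t by (simp only: mult_less_cancel_left_pos)
  then have "S * m - l - 1 < 1" by linarith
  then have "S * m \<le> l + 1" by simp
  then have "t * real_of_int (S * m) \<le> t * real_of_int (l + 1)"
    using t by (simp only: of_int_le_iff mult_le_cancel_left_pos)
  then show "s * m \<le> t * l + t" unfolding s by (simp add: algebra_simps)
  have "t * (l - S * m - S) < t * 1"
  proof -
    have "t * (l - S * m - S) = t * l - s * m - s" by (simp add: s algebra_simps)
    also have "\<dots> < t" using z le t by linarith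
    finally show ?thesis by simp
  qed
  then have "l - S * m - S < (1::real)" using t by (simp only: mult_less_cancel_left_pos)
  then have "l - S * m - S < 1" by linarith
  then have "l \<le> S * m + S" by simp
  then have "t * real_of_int l \<le> t * real_of_int (S * m + S)"
    using t by (simp only: of_int_le_iff mult_le_cancel_left_pos)
  then show "t * l \<le> s * m + s" unfolding s by (simp add: algebra_simps)
qed

text \<open>Makes corner and side available as data and retains the integrality of the coordinates,
  on which \<open>dyadic_interval_touch\<close> rests.\<close>

definition dyadic_rep :: "(real^'n) set \<Rightarrow> real^'n \<Rightarrow> real \<Rightarrow> bool" where
  "dyadic_rep Q a s \<longleftrightarrow> Q = cube a s \<and> (\<exists>k::int. s = 2 powr k \<and> (\<forall>i. \<exists>m::int. a $ i = s * m))"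

lemma dyadic_repD:
  assumes "dyadic_rep Q a s"
  shows "Q = cube a s" "0 < s"
  using assms by (auto simp: dyadic_rep_def)

lemma dyadic_cube_rep:
  assumes "dyadic_cube (Q :: (real^'n) set)"
  obtains a s where "dyadic_rep Q a s"
proof -
  obtain k :: int and b :: "real^'n" where b: "\<forall>i. b $ i \<in> \<int>"
    "Q = cbox ((2 powr of_int k) *\<^sub>R b) ((2 powr of_int k) *\<^sub>R (b + One))"
    using assms unfolding dyadic_cube_def by blast
  have "dyadic_rep Q (2 powr of_int k *\<^sub>R b) (2 powr of_int k)"
    using b unfolding dyadic_rep_def cube_def
    by (auto simp: scaleR_add_right One_eq_1 elim!: Ints_cases)
  then show ?thesis using that by blast
qed

lemma dyadic_touch_aux:
  assumes A: "dyadic_rep A a s" and B: "dyadic_rep B b t" and st: "t \<le> s" "s \<le> 6 * t"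
    and z: "z \<in> star A" "z \<in> star B"
  shows "A \<inter> B \<noteq> {}"
proof -
  obtain k j :: int where k: "s = 2 powr real_of_int k" "\<And>i. \<exists>m::int. a $ i = s * m"
    and j: "t = 2 powr real_of_int j" "\<And>i. \<exists>m::int. b $ i = t * m"
    using A B unfolding dyadic_rep_def by blast
  have kj: "j \<le> k" using st k j by simp
  \<comment> \<open>Intervals [a, a + s] and [b, b + t] that meet contain the larger of their left
    ends; the common point takes this value in every coordinate.\<close>
  define x where "x = (\<chi> i. max (a $ i) (b $ i))"
  have "x $ i \<le> a $ i + s \<and> x $ i \<le> b $ i + t" for i
  proof -
    obtain m l :: int where ml: "a $ i = s * m" "b $ i = t * l" using k j by blast
    have s0: "0 \<le> s" "0 \<le> t" using k j by auto
    have "a $ i - s/16 \<le> z $ i" "z $ i \<le> a $ i + s + s/16" "b $ i - t/16 \<le> z $ i" "z $ i \<le> b $ i + t + t/16"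
      using z s0 dyadic_repD(1)[OF A] dyadic_repD(1)[OF B] by (simp_all add: mem_star_cube)
    then have "a $ i \<le> b $ i + t" "b $ i \<le> a $ i + s"
      using dyadic_interval_touch[OF k(1) j(1) kj st(2)] unfolding ml by blast+
    then show ?thesis using s0 by (simp add: x_def)
  qed
  then have "x \<in> A \<inter> B"
    using dyadic_repD(1)[OF A] dyadic_repD(1)[OF B] by (auto simp: mem_cube x_def)
  then show ?thesis by blast
qed

lemma dyadic_touch:
  assumes "dyadic_rep A a s" "dyadic_rep B b t" "t \<le> 6 * s" "s \<le> 6 * t" "z \<in> star A" "z \<in> star B"
  shows "A \<inter> B \<noteq> {}"
  using dyadic_touch_aux[of A a s B b t z] dyadic_touch_aux[of B b t A a s z] assms by force

text \<open>The small cube is the image of the large one under the homothety with center z and ratio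
  \<eta>, which fixes z and does not leave a convex set containing z.\<close>

lemma cube_contraction:
  assumes z: "z \<in> cube a s" and \<eta>: "0 < \<eta>" "\<eta> \<le> 1" and s: "0 \<le> s"
  shows "cube (z + \<eta> *\<^sub>R (a - z)) (\<eta> * s) \<subseteq> cube a s" "z \<in> cube (z + \<eta> *\<^sub>R (a - z)) (\<eta> * s)"
proof -
  have zi: "a $ i \<le> z $ i" "z $ i \<le> a $ i + s" for i using z by (auto simp: mem_cube)
  have 1: "a $ i \<le> z $ i + \<eta> * (a $ i - z $ i)" for i
    using mult_right_mono[of \<eta> 1 "z $ i - a $ i"] zi[of i] \<eta> by (simp add: algebra_simps)
  have 2: "z $ i + \<eta> * (a $ i - z $ i) + \<eta> * s \<le> a $ i + s" for i
    using mult_right_mono[of \<eta> 1 "a $ i + s - z $ i"] zi[of i] \<eta> by (simp add: algebra_simps)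
  show "cube (z + \<eta> *\<^sub>R (a - z)) (\<eta> * s) \<subseteq> cube a s"
  proof
    fix x assume x: "x \<in> cube (z + \<eta> *\<^sub>R (a - z)) (\<eta> * s)"
    have "a $ i \<le> x $ i \<and> x $ i \<le> a $ i + s" for i
    proof -
      have "z $ i + \<eta> * (a $ i - z $ i) \<le> x $ i" "x $ i \<le> z $ i + \<eta> * (a $ i - z $ i) + \<eta> * s"
        using x by (simp_all add: mem_cube)
      then show ?thesis using 1[of i] 2[of i] by linarith
    qed
    then show "x \<in> cube a s" by (simp add: mem_cube)
  qed
  have 3: "\<eta> * (a $ i - z $ i) \<le> 0" for i
    using zi[of i] \<eta> by (simp add: mult_le_0_iff)
  have 4: "0 \<le> \<eta> * (a $ i - z $ i) + \<eta> * s" for i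
    using zi[of i] \<eta> by (simp flip: distrib_left)
  show "z \<in> cube (z + \<eta> *\<^sub>R (a - z)) (\<eta> * s)"
    using 3 4 by (auto simp: mem_cube add.assoc)
qed

section \<open>Sizes and contacts of Whitney cubes\<close>

locale whitney =
  fixes G :: "(real^'n) set" and W :: "(real^'n) set set"
  assumes open_G: "open G" and G_nonempty: "G \<noteq> {}" and bounded_G: "bounded G"
    and W: "whitney_decomposition G W"
begin

lemma Union_W: "\<Union>W = G"
  using W by (simp add: whitney_decomposition_def)

lemma W_rep:
  assumes "A \<in> W"
  obtains a s where "dyadic_rep A a s"
proof -
  have "dyadic_cube A" using assms W by (simp add: whitney_decomposition_def)
  then show ?thesis using that by (rule dyadic_cube_rep)
qed

lemma W_far:
  assumes "A \<in> W" "dyadic_rep A a s" "x \<in> A"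
  shows "s * diag TYPE('n) \<le> infdist x (frontier G)"
proof -
  have "s * diag TYPE('n) = diameter A"
    using dyadic_repD[OF assms(2)] by (simp add: diameter_cube)
  also have "\<dots> \<le> setdist A (frontier G)"
    using assms(1) W by (simp add: whitney_decomposition_def)
  also have "\<dots> \<le> infdist x (frontier G)"
    using assms(3) unfolding infdist_eq_setdist by (intro setdist_subset_left) auto
  finally show ?thesis .
qed

lemma W_near:
  assumes "A \<in> W" "dyadic_rep A a s"
  obtains y f where "y \<in> A" "f \<in> frontier G" "dist y f \<le> 4 * s * diag TYPE('n)"
proof -
  note A = dyadic_repD[OF assms(2)]
  have "a \<in> A" using A by (simp add: mem_cube)
  \<comment> \<open>The distance to an empty set is 0 by convention, which would contradict the
    positive lower bound of \<open>W_far\<close>.\<close>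
  have "frontier G \<noteq> {}"
    using W_far[OF assms \<open>a \<in> A\<close>] mult_pos_pos[OF A(2) diag_pos[where 'n='n]]
    by (auto simp: infdist_def)
  then obtain y f where "y \<in> A" "f \<in> frontier G" "dist y f = setdist A (frontier G)"
    using setdist_compact_closed[of A "frontier G"] \<open>a \<in> A\<close> A compact_cube by (metis empty_iff frontier_closed)
  moreover have "setdist A (frontier G) \<le> 4 * diameter A"
    using assms(1) W by (simp add: whitney_decomposition_def)
  ultimately show ?thesis
    using that A by (simp add: diameter_cube)
qed

text \<open>Walk from A through z into B and on to a frontier point close to B. The path has length
  at most (s/16 + t/16 + t + 4t) \<open>diag\<close>, while dist(A, \<partial>G) is at least s
  \<open>diag\<close>. This gives 15 s \<le> 81 t, and 6 is a convenient bound for 81/15.\<close>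

lemma W_ratio:
  assumes "A \<in> W" "dyadic_rep A a s" "B \<in> W" "dyadic_rep B b t" "z \<in> star A" "z \<in> star B"
  shows "s \<le> 6 * t"
proof -
  let ?c = "diag TYPE('n)"
  obtain y f where y: "y \<in> B" "f \<in> frontier G" "dist y f \<le> 4 * t * ?c"
    using W_near assms by blast
  note A = dyadic_repD[OF assms(2)] note B = dyadic_repD[OF assms(4)]
  obtain x where x: "x \<in> A" "dist x z \<le> s/16 * ?c"
    using star_cube_near[of s z a] A assms by auto
  obtain x' where x': "x' \<in> B" "dist x' z \<le> t/16 * ?c"
    using star_cube_near[of t z b] B assms by auto
  have "s * ?c \<le> dist x f"
    using W_far[OF assms(1,2) x(1)] infdist_le[OF y(2), of x] by linarith
  also have "dist x f \<le> dist x z + dist x' z + dist x' y + dist y f"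
    by metric
  also have "\<dots> \<le> s/16 * ?c + t/16 * ?c + t * ?c + 4 * t * ?c"
    using x x' y cube_dist_le[of x' b t y] B by (intro add_mono) auto
  finally have "15 * (s * ?c) \<le> 81 * (t * ?c)" by linarith
  then have "(15 * s) * ?c \<le> (81 * t) * ?c" by (simp only: mult.assoc)
  then have "15 * s \<le> 81 * t" using diag_pos[where 'n='n] by (rule mult_right_le_imp_le)
  then show ?thesis using B by simp
qed

text \<open>All that the comparison of means needs to know about intersecting stars: the cubes are
  comparable and have a common point.\<close>

lemma W_touch:
  assumes "A \<in> W" "dyadic_rep A a s" "B \<in> W" "dyadic_rep B b t" "star A \<inter> star B \<noteq> {}"
  shows "s \<le> 6 * t" "t \<le> 6 * s" "A \<inter> B \<noteq> {}"
proof -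
  obtain z where z: "z \<in> star A" "z \<in> star B" using assms by blast
  show 1: "s \<le> 6 * t" "t \<le> 6 * s"
    using W_ratio[OF assms(1-4) z] W_ratio[OF assms(3,4,1,2) z(2,1)] by auto
  show "A \<inter> B \<noteq> {}" by (rule dyadic_touch[OF assms(2,4) 1(2,1) z])
qed

text \<open>A dyadic cube is determined by its scale and an integer vector. Countability permits
  exchanging sums over W with integrals and with each other.\<close>

lemma countable_W: "countable W"
proof -
  have "\<exists>k::int. \<exists>m::int^'n. Q = cube (\<chi> i. 2 powr k * m $ i) (2 powr k)" if "Q \<in> W" for Q
  proof -
    from that obtain a s where "dyadic_rep Q a s" by (rule W_rep)
    then obtain k :: int where k: "Q = cube a s" "s = 2 powr real_of_int k" "\<forall>i. \<exists>m::int. a $ i = s * m"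
      unfolding dyadic_rep_def by blast
    then obtain m where "\<forall>i. a $ i = s * real_of_int (m i)" by metis
    then have "Q = cube (\<chi> i. 2 powr k * real_of_int ((\<chi> i. m i) $ i)) (2 powr k)"
      using k by (auto intro!: arg_cong2[where f=cube] simp: vec_eq_iff)
    then show ?thesis by blast
  qed
  then have sub: "W \<subseteq> range (\<lambda>(k::int, m::int^'n). cube (\<chi> i. 2 powr k * m $ i) (2 powr k))"
    by fastforce
  have "countable (UNIV :: int set)" by simp
  moreover have "countable (UNIV :: (int^'n) set)"
  proof -
    have "inj (\<lambda>m::int^'n. vec_nth m)" by (simp add: inj_on_def vec_nth_inject)
    moreover have "countable (UNIV :: ('n \<Rightarrow> int) set)" by simp
    ultimately show ?thesis by (metis countable_image_inj_on countable_subset subset_UNIV)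
  qed
  ultimately have "countable (range (\<lambda>(k::int, m::int^'n). cube (\<chi> i. 2 powr k * m $ i) (2 powr k)))"
    by (intro countable_image) (simp flip: UNIV_Times_UNIV)
  then show ?thesis using sub by (rule countable_subset[rotated])
qed

end

section \<open>Means over neighbouring cubes\<close>

locale whitney_frac = whitney G W for G :: "(real^'n) set" and W +
  fixes p \<delta> \<tau> :: real
  assumes p: "1 \<le> p" and \<delta>: "0 < \<delta>" and \<tau>: "0 < \<tau>" "\<tau> < 1"
begin

abbreviation "E v A \<equiv> energy G \<tau> (real CARD('n) + \<delta> * p) p v A"

text \<open>The scale is such that \<open>e v A powr p\<close> is s^(\<delta> p - n) times the
  energy of A. As \<open>enn2real\<close> sends \<infinity> to 0, the estimates by \<open>e\<close>
  assume finite energy.\<close>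

definition e :: "(real^'n \<Rightarrow> real) \<Rightarrow> (real^'n) set \<Rightarrow> real" where
  "e v A = measure lborel A powr (\<delta> / real CARD('n) - 1 / p) * enn2real (E v A) powr (1 / p)"

lemma e_nonneg: "0 \<le> e v A"
  by (simp add: e_def)

lemma exponent_pos: "0 < (real CARD('n) + \<delta> * p)"
proof -
  have "0 < \<delta> * p" using p \<delta> by simp
  then show ?thesis by (simp add: add_nonneg_pos)
qed

lemma G_borel [measurable]: "G \<in> sets borel"
  using open_G by simp

lemma W_subset: "A \<in> W \<Longrightarrow> A \<subseteq> G"
  using Union_W by blast

lemma measure_rep:
  assumes "dyadic_rep A (a :: real^'n) s"
  shows "measure lborel A = s powr real CARD('n)"
  using dyadic_repD[OF assms] by (simp add: measure_cube powr_realpow)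

lemma e_powr:
  assumes "dyadic_rep A a s" "E v A < \<infinity>"
  shows "ennreal (e v A powr p) = ennreal (s powr (\<delta> * p - real CARD('n))) * E v A"
proof -
  have "e v A powr p = s powr (real CARD('n) * (\<delta> / real CARD('n) - 1 / p) * p) * enn2real (E v A)"
    using p by (simp add: e_def powr_mult powr_powr measure_rep[OF assms(1)])
  also have "real CARD('n) * (\<delta> / real CARD('n) - 1 / p) * p = \<delta> * p - real CARD('n)" using p by (simp add: field_simps)
  finally show ?thesis using assms(2) by (simp add: ennreal_mult)
qed

text \<open>Takes p-th roots and thereby leaves [0, \<infinity>] for real arithmetic; the estimates
  of means below all reach this form.\<close>

lemma le_e:
  assumes "dyadic_rep A a s" "E v A < \<infinity>" "0 \<le> x" "0 \<le> K"
    and "ennreal (x powr p) \<le> ennreal (K * s powr (\<delta> * p - real CARD('n))) * E v A"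
  shows "x \<le> K powr (1 / p) * e v A"
proof -
  have "ennreal (x powr p) \<le> ennreal K * ennreal (e v A powr p)"
    unfolding e_powr[OF assms(1,2)] using assms(4,5) by (simp add: ennreal_mult mult.assoc)
  then have "x powr p \<le> K * e v A powr p"
    using assms(4) by (simp flip: ennreal_mult)
  then have "(x powr p) powr (1 / p) \<le> (K * e v A powr p) powr (1 / p)"
    using p by (intro powr_mono2) auto
  then show ?thesis using p assms e_nonneg[of v A] by (simp add: powr_powr powr_mult)
qed

lemma cube_oscillation:
  "\<exists>C>0. \<forall>v A a s. v \<in> borel_measurable borel \<longrightarrow> A \<in> W \<longrightarrow> dyadic_rep A a s \<longrightarrow>
      oscillation p v A A (s * diag TYPE('n)) \<le> ennreal (C * s powr (real CARD('n) + \<delta> * p)) * E v A"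
proof -
  \<comment> \<open>After k halvings the distance is at most s \<open>diag\<close> / 2^k < \<tau> s
    \<open>diag\<close>, hence below \<tau> dist(x, \<partial>G).\<close>
  obtain k where k: "(1/2)^k < \<tau>" using real_arch_pow_inv[of \<tau> "1/2"] \<tau> by auto
  define K where "K = (2 powr p * 2 * 2 ^ DIM(real^'n)) ^ k"
  have K: "K > 0" by (simp add: K_def)
  show ?thesis
  proof (intro exI[of _ "K * diag TYPE('n) powr (real CARD('n) + \<delta> * p)"] conjI allI impI)
    show "0 < K * diag TYPE('n) powr (real CARD('n) + \<delta> * p)" using K by simp
    fix v :: "real^'n \<Rightarrow> real" and A a s
    assume v: "v \<in> borel_measurable borel" and A: "A \<in> W" and r: "dyadic_rep A a s"
    note AD = dyadic_repD[OF r]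
    have sc: "s * diag TYPE('n) > 0" using AD by simp
    have "oscillation p v A A (s * diag TYPE('n)) \<le> ennreal K * oscillation p v A A (s * diag TYPE('n) / 2 ^ k)"
      unfolding K_def by (rule oscillation_halve_iterated) (use v AD p in \<open>auto simp: convex_cube\<close>)
    also have "oscillation p v A A (s * diag TYPE('n) / 2 ^ k) \<le> ennreal ((s * diag TYPE('n) / 2 ^ k) powr (real CARD('n) + \<delta> * p)) * E v A"
    proof (rule oscillation_le_energy)
      fix x assume x: "x \<in> A"
      have "s * diag TYPE('n) / 2 ^ k < \<tau> * (s * diag TYPE('n))"
        using mult_strict_right_mono[OF k sc] by (simp add: power_one_over)
      also have "\<dots> \<le> \<tau> * infdist x (frontier G)"
        using W_far[OF A r x] \<tau> by (intro mult_left_mono) auto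
      finally show "s * diag TYPE('n) / 2 ^ k < \<tau> * infdist x (frontier G)" .
    qed (use v AD exponent_pos p W_subset[OF A] in auto)
    \<comment> \<open>The gain from the smaller radius is discarded, since k depends on \<tau>
      only.\<close>
    also have "ennreal ((s * diag TYPE('n) / 2 ^ k) powr (real CARD('n) + \<delta> * p)) \<le> ennreal ((s * diag TYPE('n)) powr (real CARD('n) + \<delta> * p))"
      using sc exponent_pos by (intro ennreal_leI powr_mono2) (auto simp: divide_le_eq mult_le_cancel_left1)
    finally show "oscillation p v A A (s * diag TYPE('n)) \<le> ennreal (K * diag TYPE('n) powr (real CARD('n) + \<delta> * p) * s powr (real CARD('n) + \<delta> * p)) * E v A"
      using K AD by (simp add: ennreal_mult powr_mult mult_left_mono mult_right_mono ac_simps)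
  qed
qed

text \<open>The two volumes contribute s^(-2n) and the oscillation s^(n + \<delta> p); their product
  s^(\<delta> p - n) is the scale built into \<open>e\<close>. Both comparisons in
  \<open>mean_step\<close> have this pattern.\<close>

lemma mean_diff_le_e:
  assumes "dyadic_rep A a s" "E v A < \<infinity>" "v \<in> borel_measurable borel"
    and S: "S \<in> sets borel" "emeasure lborel S < \<infinity>" "0 < measure lborel S" "set_integrable lborel S v"
    and T: "T \<in> sets borel" "emeasure lborel T < \<infinity>" "0 < measure lborel T" "set_integrable lborel T v"
    and r: "\<And>x y. x \<in> S \<Longrightarrow> y \<in> T \<Longrightarrow> dist x y \<le> r"
    and vol: "1 / (measure lborel S * measure lborel T) \<le> K * s powr (- 2 * real CARD('n))"
    and osc: "oscillation p v S T r \<le> ennreal (K' * s powr (real CARD('n) + \<delta> * p)) * E v A"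
    and K: "0 \<le> K" "0 \<le> K'"
  shows "\<bar>mean S v - mean T v\<bar> \<le> (4 powr p * K * K') powr (1 / p) * e v A"
proof (rule le_e[OF assms(1,2)])
  have "ennreal (\<bar>mean S v - mean T v\<bar> powr p)
    \<le> ennreal (4 powr p / (measure lborel S * measure lborel T)) * oscillation p v S T r"
    by (rule mean_diff_oscillation) (use assms p in auto)
  also have "\<dots> \<le> ennreal (4 powr p * (K * s powr (- 2 * real CARD('n)))) * (ennreal (K' * s powr (real CARD('n) + \<delta> * p)) * E v A)"
  proof (intro mult_mono osc ennreal_leI)
    have "4 powr p * (1 / (measure lborel S * measure lborel T)) \<le> 4 powr p * (K * s powr (- 2 * real CARD('n)))"
      by (intro mult_left_mono vol) auto
    then show "4 powr p / (measure lborel S * measure lborel T) \<le> 4 powr p * (K * s powr (- 2 * real CARD('n)))" by simp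
  qed auto
  also have "\<dots> = ennreal (4 powr p * (K * s powr (- 2 * real CARD('n))) * (K' * s powr (real CARD('n) + \<delta> * p))) * E v A"
    using K by (simp only: ennreal_mult powr_ge_zero mult_nonneg_nonneg mult.assoc)
  also have "4 powr p * (K * s powr (- 2 * real CARD('n))) * (K' * s powr (real CARD('n) + \<delta> * p)) = 4 powr p * K * K' * (s powr (- 2 * real CARD('n)) * s powr (real CARD('n) + \<delta> * p))"
    by (simp only: ac_simps)
  also have "s powr (- 2 * real CARD('n)) * s powr (real CARD('n) + \<delta> * p) = s powr (\<delta> * p - real CARD('n))"
    by (simp flip: powr_add)
  finally show "ennreal (\<bar>mean S v - mean T v\<bar> powr p) \<le> ennreal (4 powr p * K * K' * s powr (\<delta> * p - real CARD('n))) * E v A" .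
qed (use K in auto)

text \<open>The bound is written as \<open>measure lborel A\<close> times a p-th power so that
  \<open>nn_integral_powr_exponent_le\<close> applies with \<mu> = C \<open>e v A\<close>.\<close>

lemma mean_deviation_e:
  "\<exists>C>0. \<forall>v A. v \<in> borel_measurable borel \<longrightarrow> set_integrable lborel G v \<longrightarrow> A \<in> W \<longrightarrow> E v A < \<infinity> \<longrightarrow>
      (\<integral>\<^sup>+x. ennreal (\<bar>v x - mean A v\<bar> powr p) * indicator A x \<partial>lborel)
        \<le> ennreal (measure lborel A * (C * e v A) powr p)"
proof -
  obtain C where C: "C > 0" and osc: "\<And>v A a s. v \<in> borel_measurable borel \<Longrightarrow> A \<in> W \<Longrightarrow> dyadic_rep A a s \<Longrightarrow>
      oscillation p v A A (s * diag TYPE('n)) \<le> ennreal (C * s powr (real CARD('n) + \<delta> * p)) * E v A"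
    using cube_oscillation by blast
  show ?thesis
  proof (intro exI[of _ "(2 powr p * C) powr (1/p)"] conjI allI impI)
    show "0 < (2 powr p * C) powr (1/p)" using C by simp
    fix v :: "real^'n \<Rightarrow> real" and A
    assume v: "v \<in> borel_measurable borel" "set_integrable lborel G v" and A: "A \<in> W" and fin: "E v A < \<infinity>"
    obtain a s where r: "dyadic_rep A a s" using W_rep[OF A] .
    note AD = dyadic_repD[OF r]
    have "(\<integral>\<^sup>+x. ennreal (\<bar>v x - mean A v\<bar> powr p) * indicator A x \<partial>lborel)
       \<le> ennreal (2 powr p / measure lborel A) * oscillation p v A A (s * diag TYPE('n))"
      using AD set_integrable_subset[OF v(2) _ W_subset[OF A]]
      by (intro mean_deviation_oscillation)
         (auto simp: v p cube_dist_le measure_cube emeasure_cube_finite[unfolded infinity_ennreal_def])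
    also have "\<dots> \<le> ennreal (2 powr p / measure lborel A) * (ennreal (C * s powr (real CARD('n) + \<delta> * p)) * E v A)"
      by (intro mult_left_mono osc[OF v(1) A r]) auto
    also have "\<dots> = ennreal (2 powr p / measure lborel A * (C * s powr (real CARD('n) + \<delta> * p))) * E v A"
      using C by (simp only: ennreal_mult powr_ge_zero mult_nonneg_nonneg mult.assoc divide_nonneg_nonneg measure_nonneg less_imp_le)
    also have "2 powr p / measure lborel A * (C * s powr (real CARD('n) + \<delta> * p)) = 2 powr p * C * measure lborel A * s powr (\<delta> * p - real CARD('n))"
      using AD unfolding measure_rep[OF r] by (simp add: powr_add powr_diff)
    also have "ennreal (2 powr p * C * measure lborel A * s powr (\<delta> * p - real CARD('n))) * E v A
        = ennreal (2 powr p * C * measure lborel A) * ennreal (e v A powr p)"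
      using C unfolding e_powr[OF r fin] by (simp only: ennreal_mult powr_ge_zero mult_nonneg_nonneg mult.assoc measure_nonneg less_imp_le)
    also have "\<dots> = ennreal (measure lborel A * ((2 powr p * C) powr (1/p) * e v A) powr p)"
      using C p e_nonneg[of v A] by (simp add: powr_mult powr_powr ac_simps flip: ennreal_mult)
    finally show "(\<integral>\<^sup>+x. ennreal (\<bar>v x - mean A v\<bar> powr p) * indicator A x \<partial>lborel)
        \<le> ennreal (measure lborel A * ((2 powr p * C) powr (1/p) * e v A) powr p)" .
  qed
qed

lemma mean_step:
  "\<exists>C>0. \<forall>v A B. v \<in> borel_measurable borel \<longrightarrow> set_integrable lborel G v \<longrightarrow> A \<in> W \<longrightarrow> B \<in> W \<longrightarrow>
      E v A < \<infinity> \<longrightarrow> E v B < \<infinity> \<longrightarrow> star A \<inter> star B \<noteq> {} \<longrightarrow>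
      \<bar>mean A v - mean B v\<bar> \<le> C * (e v A + e v B)"
proof -
  obtain C where C: "C > 0" and osc: "\<And>v A a s. v \<in> borel_measurable borel \<Longrightarrow> A \<in> W \<Longrightarrow> dyadic_rep A a s \<Longrightarrow>
      oscillation p v A A (s * diag TYPE('n)) \<le> ennreal (C * s powr (real CARD('n) + \<delta> * p)) * E v A"
    using cube_oscillation by blast
  \<comment> \<open>Points of the two contracted cubes are at distance at most \<eta> (s + t)
    \<open>diag\<close> \<le> 7 \<eta> s \<open>diag\<close>, because both contain z and t \<le> 6s.
    With \<eta> = \<tau>/8 this is strictly below \<tau> s \<open>diag\<close>.\<close>
  define \<eta> where "\<eta> = \<tau> / 8"
  have \<eta>: "0 < \<eta>" "\<eta> \<le> 1" using \<tau> by (auto simp: \<eta>_def)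
  define K1 where "K1 = (4 powr p * \<eta> powr (- real CARD('n)) * C) powr (1 / p)"
  define K2 where "K2 = (4 powr p * (6 powr real CARD('n) * \<eta> powr (- 2 * real CARD('n))) * diag TYPE('n) powr (real CARD('n) + \<delta> * p)) powr (1 / p)"
  have K: "K1 > 0" "K2 > 0" using C \<eta> by (auto simp: K1_def K2_def)
  let ?A' = "\<lambda>z a s. cube (z + \<eta> *\<^sub>R (a - z)) (\<eta> * s)"
  \<comment> \<open>The contracted cube occupies the fixed share \<eta>^n of A, so its mean is
    compared with that of A by the oscillation over A x A.\<close>
  have contract: "\<bar>mean A v - mean (?A' z a s) v\<bar> \<le> K1 * e v A"
    if v: "v \<in> borel_measurable borel" "set_integrable lborel G v" and A: "A \<in> W" and fin: "E v A < \<infinity>"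
      and r: "dyadic_rep A a s" and z: "z \<in> A" for v A z a s
    unfolding K1_def
  proof (rule mean_diff_le_e[OF r fin v(1)])
    note AD = dyadic_repD[OF r]
    have sub: "?A' z a s \<subseteq> A" using cube_contraction(1)[of z a s \<eta>] z AD \<eta> by simp
    show "A \<in> sets borel" "emeasure lborel A < \<infinity>" "0 < measure lborel A"
      using AD emeasure_cube_finite by (auto simp: measure_cube)
    show "?A' z a s \<in> sets borel" "emeasure lborel (?A' z a s) < \<infinity>" "0 < measure lborel (?A' z a s)"
      using AD \<eta> emeasure_cube_finite by (auto simp: measure_cube)
    show "set_integrable lborel A v" "set_integrable lborel (?A' z a s) v"
      using set_integrable_subset[OF v(2)] W_subset[OF A] sub AD by (auto intro: order_trans)
    show "dist x y \<le> s * diag TYPE('n)" if "x \<in> A" "y \<in> ?A' z a s" for x y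
      using that sub AD cube_dist_le by blast
    show "1 / (measure lborel A * measure lborel (?A' z a s)) \<le> \<eta> powr (- real CARD('n)) * s powr (- 2 * real CARD('n))"
      using AD \<eta> unfolding measure_rep[OF r]
      by (simp add: measure_cube powr_realpow[symmetric] powr_mult powr_minus divide_simps flip: powr_add)
    have "oscillation p v A (?A' z a s) (s * diag TYPE('n)) \<le> oscillation p v A A (s * diag TYPE('n))"
      by (rule oscillation_mono) (use sub in auto)
    also have "\<dots> \<le> ennreal (C * s powr (real CARD('n) + \<delta> * p)) * E v A" by (rule osc[OF v(1) A r])
    finally show "oscillation p v A (?A' z a s) (s * diag TYPE('n)) \<le> ennreal (C * s powr (real CARD('n) + \<delta> * p)) * E v A" .
  qed (use C in auto)
  \<comment> \<open>All pairs are admissible here, so no halving occurs; and since only the first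
    point needs a large ball, the energy of A suffices.\<close>
  have across: "\<bar>mean (?A' z a s) v - mean (?A' z b t) v\<bar> \<le> K2 * e v A"
    if v: "v \<in> borel_measurable borel" "set_integrable lborel G v" and A: "A \<in> W" and fin: "E v A < \<infinity>"
      and r: "dyadic_rep A a s" and z: "z \<in> A" "z \<in> B" and B: "B \<in> W" and r': "dyadic_rep B b t"
      and st: "s \<le> 6 * t" "t \<le> 6 * s"
      for v A B z a s b t
    unfolding K2_def
  proof (rule mean_diff_le_e[OF r fin v(1)])
    note AD = dyadic_repD[OF r] and BD = dyadic_repD[OF r']
    have sub: "?A' z a s \<subseteq> A" "z \<in> ?A' z a s" using cube_contraction[of z a s \<eta>] z AD \<eta> by simp_all
    have sub': "?A' z b t \<subseteq> B" "z \<in> ?A' z b t" using cube_contraction[of z b t \<eta>] z BD \<eta> by simp_all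
    show "?A' z a s \<in> sets borel" "emeasure lborel (?A' z a s) < \<infinity>" "0 < measure lborel (?A' z a s)"
      using AD \<eta> emeasure_cube_finite by (auto simp: measure_cube)
    show "?A' z b t \<in> sets borel" "emeasure lborel (?A' z b t) < \<infinity>" "0 < measure lborel (?A' z b t)"
      using BD \<eta> emeasure_cube_finite by (auto simp: measure_cube)
    show "set_integrable lborel (?A' z a s) v" "set_integrable lborel (?A' z b t) v"
      using set_integrable_subset[OF v(2)] W_subset[OF A] W_subset[OF B] sub sub' by (auto intro: order_trans)
    show "dist x y \<le> 7/8 * \<tau> * (s * diag TYPE('n))" if "x \<in> ?A' z a s" "y \<in> ?A' z b t" for x y
    proof -
      have "dist x y \<le> dist x z + dist z y" by metric
      also have "\<dots> \<le> \<eta> * s * diag TYPE('n) + \<eta> * t * diag TYPE('n)"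
        using cube_dist_le[OF that(1) sub(2)] cube_dist_le[OF sub'(2) that(2)] by (rule add_mono)
      also have "\<dots> = \<eta> * diag TYPE('n) * (s + t)" by (simp add: algebra_simps)
      also have "\<dots> \<le> \<eta> * diag TYPE('n) * (7 * s)" using st \<eta> by (intro mult_left_mono) auto
      finally show ?thesis by (simp add: \<eta>_def algebra_simps)
    qed
    have "1 / (measure lborel (?A' z a s) * measure lborel (?A' z b t)) = 1 / ((\<eta> * s) powr real CARD('n) * (\<eta> * t) powr real CARD('n))"
      using AD BD \<eta> by (simp add: measure_cube powr_realpow)
    \<comment> \<open>From t \<ge> s/6 both volumes are bounded below by powers of s; this is the
      origin of 6 powr n in \<open>K2\<close>.\<close>
    also have "\<dots> \<le> 1 / ((\<eta> * s) powr real CARD('n) * (\<eta> * (s / 6)) powr real CARD('n))"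
      using AD BD \<eta> st by (intro divide_left_mono mult_left_mono powr_mono2 mult_pos_pos) auto
    also have "\<dots> = 6 powr real CARD('n) * \<eta> powr (- 2 * real CARD('n)) * s powr (- 2 * real CARD('n))"
    proof -
      have "\<eta> powr (- 2 * real CARD('n)) = 1 / (\<eta> powr real CARD('n) * \<eta> powr real CARD('n))" "s powr (- 2 * real CARD('n)) = 1 / (s powr real CARD('n) * s powr real CARD('n))"
        using powr_add[of \<eta> "real CARD('n)" "real CARD('n)"] powr_add[of s "real CARD('n)" "real CARD('n)"] by (simp_all add: powr_minus_divide)
      then show ?thesis using AD \<eta> by (simp add: powr_mult powr_divide)
    qed
    finally show "1 / (measure lborel (?A' z a s) * measure lborel (?A' z b t))
        \<le> 6 powr real CARD('n) * \<eta> powr (- 2 * real CARD('n)) * s powr (- 2 * real CARD('n))" .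
    have sc: "0 < s * diag TYPE('n)" using AD by simp
    have "oscillation p v (?A' z a s) (?A' z b t) (7/8 * \<tau> * (s * diag TYPE('n)))
        \<le> ennreal ((7/8 * \<tau> * (s * diag TYPE('n))) powr (real CARD('n) + \<delta> * p)) * E v (?A' z a s)"
    proof (rule oscillation_le_energy)
      fix x assume "x \<in> ?A' z a s"
      then have "s * diag TYPE('n) \<le> infdist x (frontier G)" using W_far[OF A r] sub by blast
      then have "\<tau> * (s * diag TYPE('n)) \<le> \<tau> * infdist x (frontier G)" using \<tau> by (intro mult_left_mono) auto
      moreover have "0 < \<tau> * (s * diag TYPE('n))" using sc \<tau> by simp
      ultimately show "7/8 * \<tau> * (s * diag TYPE('n)) < \<tau> * infdist x (frontier G)"
        unfolding mult.assoc by linarith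
    qed (use v exponent_pos p sub' W_subset[OF B] in auto)
    also have "\<dots> \<le> ennreal (diag TYPE('n) powr (real CARD('n) + \<delta> * p) * s powr (real CARD('n) + \<delta> * p)) * E v A"
    proof (intro mult_mono energy_mono sub ennreal_leI)
      have "7/8 * \<tau> * (s * diag TYPE('n)) \<le> 1 * (s * diag TYPE('n))"
        using sc \<tau> by (intro mult_right_mono) auto
      then have "(7/8 * \<tau> * (s * diag TYPE('n))) powr (real CARD('n) + \<delta> * p) \<le> (s * diag TYPE('n)) powr (real CARD('n) + \<delta> * p)"
        using sc exponent_pos \<tau> by (intro powr_mono2) auto
      then show "(7/8 * \<tau> * (s * diag TYPE('n))) powr (real CARD('n) + \<delta> * p) \<le> diag TYPE('n) powr (real CARD('n) + \<delta> * p) * s powr (real CARD('n) + \<delta> * p)"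
        using AD by (simp add: powr_mult mult.commute)
    qed auto
    finally show "oscillation p v (?A' z a s) (?A' z b t) (7/8 * \<tau> * (s * diag TYPE('n))) \<le> ennreal (diag TYPE('n) powr (real CARD('n) + \<delta> * p) * s powr (real CARD('n) + \<delta> * p)) * E v A" .
  qed auto
  show ?thesis
  proof (intro exI[of _ "K1 + K2"] conjI allI impI)
    show "0 < K1 + K2" using K by simp
    fix v :: "real^'n \<Rightarrow> real" and A B
    assume v: "v \<in> borel_measurable borel" "set_integrable lborel G v" and A: "A \<in> W" and B: "B \<in> W"
      and fin: "E v A < \<infinity>" "E v B < \<infinity>" and meet: "star A \<inter> star B \<noteq> {}"
    obtain a s where r: "dyadic_rep A a s" using W_rep[OF A] .
    obtain b t where r': "dyadic_rep B b t" using W_rep[OF B] .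
    note touch = W_touch[OF A r B r' meet]
    then obtain z where z: "z \<in> A" "z \<in> B" by blast
    have "\<bar>mean A v - mean B v\<bar> \<le> \<bar>mean A v - mean (?A' z a s) v\<bar>
        + \<bar>mean (?A' z a s) v - mean (?A' z b t) v\<bar> + \<bar>mean B v - mean (?A' z b t) v\<bar>" by linarith
    also have "\<dots> \<le> K1 * e v A + K2 * e v A + K1 * e v B"
      by (intro add_mono contract across[OF v A fin(1) r z B r' touch(1,2)] v A B fin r r' z)
    also have "\<dots> \<le> (K1 + K2) * (e v A + e v B)"
      using K e_nonneg[of v B] by (simp add: algebra_simps)
    finally show "\<bar>mean A v - mean B v\<bar> \<le> (K1 + K2) * (e v A + e v B)" .
  qed
qed

end

section \<open>Chains\<close>

text \<open>Summability is essential: \<open>infsum\<close> of a family that is not summable is 0,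
  whereas the integral would be \<infinity>.\<close>

lemma nn_integral_count_space_infsum:
  fixes f :: "'a \<Rightarrow> real"
  assumes "f summable_on X" "\<And>x. x \<in> X \<Longrightarrow> 0 \<le> f x"
  shows "(\<integral>\<^sup>+x. ennreal (f x) \<partial>count_space X) = ennreal (infsum f X)"
proof -
  have "Infinite_Sum.abs_summable_on f X"
    using assms(1) by (rule summable_on_iff_abs_summable_on_real[THEN iffD1])
  then have "Infinite_Set_Sum.abs_summable_on f X" by (rule abs_summable_equivalent[THEN iffD1])
  then show ?thesis using assms(2) by (simp add: nn_integral_conv_infsetsum infsetsum_infsum)
qed

text \<open>The definition of a chain decomposition admits the chain (Q0, Q0), so a chain may repeat a cube
  once.\<close>

lemma sum_nth_le_sum_set:
  fixes f :: "'a \<Rightarrow> real"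
  assumes inj: "\<And>i j. i < length xs \<Longrightarrow> j < length xs \<Longrightarrow> xs ! i = xs ! j \<Longrightarrow> \<bar>int i - int j\<bar> \<le> 1"
    and nn: "\<And>x. 0 \<le> f x"
  shows "(\<Sum>i<length xs. f (xs ! i)) \<le> 2 * (\<Sum>x\<in>set xs. f x)"
proof -
  have "(\<Sum>i<length xs. f (xs ! i)) = (\<Sum>x\<in>(!) xs ` {..<length xs}. \<Sum>i\<in>{i\<in>{..<length xs}. xs ! i = x}. f (xs ! i))"
    by (rule sum.image_gen) simp
  also have "(!) xs ` {..<length xs} = set xs" by (auto simp: in_set_conv_nth)
  also have "(\<Sum>x\<in>set xs. \<Sum>i\<in>{i\<in>{..<length xs}. xs ! i = x}. f (xs ! i)) \<le> (\<Sum>x\<in>set xs. 2 * f x)"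
  proof (rule sum_mono)
    fix x assume "x \<in> set xs"
    let ?S = "{i\<in>{..<length xs}. xs ! i = x}"
    have ne: "?S \<noteq> {}" using \<open>x \<in> set xs\<close> by (auto simp: in_set_conv_nth)
    \<comment> \<open>Any two indices with the same entry differ by at most 1, so only the smallest
      one and its successor are possible.\<close>
    have "?S \<subseteq> {Min ?S, Min ?S + 1}"
    proof
      fix i assume i: "i \<in> ?S"
      have "Min ?S \<in> ?S" by (rule Min_in) (use ne in auto)
      moreover have "Min ?S \<le> i" by (rule Min_le) (use i in auto)
      moreover have "\<bar>int i - int (Min ?S)\<bar> \<le> 1"
        by (rule inj) (use i \<open>Min ?S \<in> ?S\<close> in auto)
      ultimately have "i = Min ?S \<or> i = Min ?S + 1" by linarith
      then show "i \<in> {Min ?S, Min ?S + 1}" by simp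
    qed
    then have "card ?S \<le> card {Min ?S, Min ?S + 1}" by (intro card_mono) auto
    also have "\<dots> \<le> 2" by (simp add: card_insert_if)
    finally have "real (card ?S) \<le> 2" by simp
    moreover have "(\<Sum>i\<in>?S. f (xs ! i)) = real (card ?S) * f x" by simp
    ultimately show "(\<Sum>i\<in>?S. f (xs ! i)) \<le> 2 * f x"
      using nn[of x] by (simp add: mult_right_mono)
  qed
  finally show ?thesis by (simp add: sum_distrib_left)
qed

lemma chain_decompositionD:
  assumes "chain_decomposition W Q0 C" "Q \<in> W"
  shows "Q0 \<in> W" "C Q \<noteq> []" "hd (C Q) = Q0" "last (C Q) = Q" "set (C Q) \<subseteq> W"
    and "\<And>i j. i < length (C Q) \<Longrightarrow> j < length (C Q) \<Longrightarrow>
      star (C Q ! i) \<inter> star (C Q ! j) \<noteq> {} \<longleftrightarrow> \<bar>int i - int j\<bar> \<le> 1"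
  using assms unfolding chain_decomposition_def by auto

context whitney_frac
begin

lemma E_finite: "E v G < \<infinity> \<Longrightarrow> A \<in> W \<Longrightarrow> E v A < \<infinity>"
  using energy_mono[OF W_subset] le_less_trans by blast

text \<open>The cubes share boundary points, but faces are null sets: passing to the interiors
  leaves each energy unchanged and makes the sets disjoint.\<close>

lemma sum_energy_le:
  assumes v: "v \<in> borel_measurable borel"
  shows "(\<integral>\<^sup>+A. E v A \<partial>count_space W) \<le> E v G"
proof -
  let ?g = "gagliardo G \<tau> (real CARD('n) + \<delta> * p) p v"
  have int: "E v A = (\<integral>\<^sup>+x. ?g x * indicator (interior A) x \<partial>lborel)" if "A \<in> W" for A
    unfolding energy_def
  proof (rule nn_integral_cong_AE)
    from that obtain a s where "dyadic_rep A a s" by (rule W_rep)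
    then have A: "A = cbox a (a + s *\<^sub>R 1)" using dyadic_repD(1) by (simp add: cube_def)
    have "negligible (A - interior A)"
      unfolding A interior_cbox by (rule negligible_frontier_interval)
    then have "AE x in lborel. x \<notin> A - interior A"
      unfolding A by (intro AE_not_in) (simp add: null_sets_completion_iff negligible_iff_null_sets)
    then show "AE x in lborel. ?g x * indicator A x = ?g x * indicator (interior A) x"
      by eventually_elim (use interior_subset in \<open>auto simp: indicator_def\<close>)
  qed
  have "(\<integral>\<^sup>+A. E v A \<partial>count_space W) = (\<integral>\<^sup>+A. (\<integral>\<^sup>+x. ?g x * indicator (interior A) x \<partial>lborel) \<partial>count_space W)"
    by (intro nn_integral_cong) (simp add: int)
  also have "\<dots> = (\<integral>\<^sup>+x. (\<integral>\<^sup>+A. ?g x * indicator (interior A) x \<partial>count_space W) \<partial>lborel)"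
  proof -
    have [measurable]: "?g \<in> borel_measurable borel" using v G_borel by (rule gagliardo_measurable)
    have [measurable]: "interior A \<in> sets borel" for A :: "(real^'n) set" by simp
    show ?thesis by (intro nn_integral_count_space_nn_integral[symmetric] countable_W) measurable
  qed
  also have "\<dots> \<le> (\<integral>\<^sup>+x. ?g x * indicator G x \<partial>lborel)"
  proof (rule nn_integral_mono)
    fix x
    show "(\<integral>\<^sup>+A. ?g x * indicator (interior A) x \<partial>count_space W) \<le> ?g x * indicator G x"
    proof (cases "\<exists>B\<in>W. x \<in> interior B")
      case True
      then obtain B where B: "B \<in> W" "x \<in> interior B" by blast
      have "x \<notin> interior A" if "A \<in> W" "A \<noteq> B" for A
        using W B that unfolding whitney_decomposition_def by blast
      then have "(\<integral>\<^sup>+A. ?g x * indicator (interior A) x \<partial>count_space W) = (\<Sum>A\<in>{B}. ?g x * indicator (interior A) x)"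
        using B by (intro nn_integral_count_space') (auto simp: indicator_def)
      moreover have "x \<in> G" using B W_subset interior_subset by blast
      ultimately show ?thesis using B by simp
    next
      case False
      then have "(\<integral>\<^sup>+A. ?g x * indicator (interior A) x \<partial>count_space W) = (\<integral>\<^sup>+A. 0 \<partial>count_space W)"
        by (intro nn_integral_cong) auto
      then show ?thesis by simp
    qed
  qed
  finally show ?thesis by (simp add: energy_def)
qed

lemma chain_estimate:
  assumes q: "1 \<le> q" "q \<le> p"
  shows "\<exists>C>0. \<forall>v Q0 Ch Q. chain_decomposition W Q0 Ch \<longrightarrow> v \<in> borel_measurable borel \<longrightarrow>
      set_integrable lborel G v \<longrightarrow> E v G < \<infinity> \<longrightarrow> Q \<in> W \<longrightarrow>
      (\<integral>\<^sup>+x. ennreal (\<bar>v x - mean Q0 v\<bar> powr q) * indicator Q x \<partial>lborel)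
        \<le> ennreal (C * measure lborel Q * (\<Sum>A\<in>set (Ch Q). e v A) powr q)"
proof -
  obtain C1 where C1: "C1 > 0" and dev: "\<And>v A. v \<in> borel_measurable borel \<Longrightarrow> set_integrable lborel G v
      \<Longrightarrow> A \<in> W \<Longrightarrow> E v A < \<infinity> \<Longrightarrow>
      (\<integral>\<^sup>+x. ennreal (\<bar>v x - mean A v\<bar> powr p) * indicator A x \<partial>lborel)
        \<le> ennreal (measure lborel A * (C1 * e v A) powr p)"
    using mean_deviation_e by blast
  obtain C2 where C2: "C2 > 0" and step: "\<And>v A B. v \<in> borel_measurable borel \<Longrightarrow> set_integrable lborel G v
      \<Longrightarrow> A \<in> W \<Longrightarrow> B \<in> W \<Longrightarrow> E v A < \<infinity> \<Longrightarrow> E v B < \<infinity> \<Longrightarrow> star A \<inter> star B \<noteq> {} \<Longrightarrow>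
      \<bar>mean A v - mean B v\<bar> \<le> C2 * (e v A + e v B)"
    using mean_step by blast
  \<comment> \<open>2 powr q splits the deviation from \<open>mean Q0 v\<close> into that from
    \<open>mean Q v\<close> and the difference of the means. \<open>2 * C1 powr q\<close> comes from
    lowering the exponent from p to q, and 4 = 2 * 2 from cubes lying in two consecutive pairs and
    from possible repetitions.\<close>
  define C where "C = 2 powr q * (2 * C1 powr q + (4 * C2) powr q)"
  show ?thesis
  proof (intro exI[of _ C] conjI allI impI)
    show "0 < C" using C1 C2 by (simp add: C_def add_pos_pos)
    fix v :: "real^'n \<Rightarrow> real" and Q0 Ch Q
    assume ch: "chain_decomposition W Q0 Ch" and v: "v \<in> borel_measurable borel" "set_integrable lborel G v"
      and fin: "E v G < \<infinity>" and Q: "Q \<in> W"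
    note ch = chain_decompositionD[OF ch Q]
    define xs where "xs = Ch Q"
    define T where "T = (\<Sum>A\<in>set xs. e v A)"
    have T: "T \<ge> 0" unfolding T_def by (intro sum_nonneg e_nonneg)
    have mem: "xs ! i \<in> W" if "i < length xs" for i
      using ch(5) that nth_mem unfolding xs_def by blast
    have tele: "\<bar>mean (xs ! 0) v - mean (xs ! i) v\<bar> \<le> C2 * (\<Sum>j<i. e v (xs ! j) + e v (xs ! Suc j))"
      if "i < length xs" for i
      using that
    proof (induction i)
      case (Suc i)
      have "star (xs ! i) \<inter> star (xs ! Suc i) \<noteq> {}"
        using ch(6)[of i "Suc i"] Suc.prems by (simp add: xs_def)
      then have "\<bar>mean (xs ! i) v - mean (xs ! Suc i) v\<bar> \<le> C2 * (e v (xs ! i) + e v (xs ! Suc i))"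
        by (intro step v mem E_finite[OF fin]) (use Suc.prems in auto)
      then show ?case using Suc by (simp add: distrib_left)
    qed simp
    define m where "m = length xs - 1"
    have len: "length xs = Suc m" using ch(2) by (simp add: m_def xs_def)
    have "\<bar>mean Q0 v - mean Q v\<bar> \<le> C2 * (\<Sum>j<m. e v (xs ! j) + e v (xs ! Suc j))"
      using tele[of m] len ch(2,3,4) by (simp add: xs_def hd_conv_nth last_conv_nth)
    \<comment> \<open>Every position of the chain belongs to at most two consecutive pairs.\<close>
    also have "(\<Sum>j<m. e v (xs ! j) + e v (xs ! Suc j)) \<le> 2 * (\<Sum>i<length xs. e v (xs ! i))"
    proof -
      have "(\<Sum>j<m. e v (xs ! j)) \<le> (\<Sum>i<length xs. e v (xs ! i))"
        by (intro sum_mono2) (auto simp: len e_nonneg)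
      moreover have "(\<Sum>j<m. e v (xs ! Suc j)) \<le> (\<Sum>i<length xs. e v (xs ! i))"
        unfolding len sum.lessThan_Suc_shift using e_nonneg[of v "xs ! 0"] by simp
      ultimately show ?thesis by (simp add: sum.distrib)
    qed
    also have "(\<Sum>i<length xs. e v (xs ! i)) \<le> 2 * T"
      unfolding T_def
    proof (rule sum_nth_le_sum_set)
      fix i j assume "i < length xs" "j < length xs" "xs ! i = xs ! j"
      then show "\<bar>int i - int j\<bar> \<le> 1" using ch(6)[of i j] ch(6)[of i i] by (simp add: xs_def)
    qed (rule e_nonneg)
    finally have mm: "\<bar>mean Q0 v - mean Q v\<bar> \<le> 4 * C2 * T" using C2 by simp
    have "last xs \<in> set xs" using ch(2) unfolding xs_def by (rule last_in_set)
    then have eQ: "e v Q \<le> T"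
      unfolding T_def using ch(4) by (intro member_le_sum) (auto simp: e_nonneg xs_def)
    obtain a s where r: "dyadic_rep Q a s" using W_rep[OF Q] .
    have Qb [measurable]: "Q \<in> sets borel" using dyadic_repD(1)[OF r] by simp
    have Qf: "emeasure lborel Q < \<infinity>" using dyadic_repD(1)[OF r] emeasure_cube_finite by blast
    then have Qe: "emeasure lborel Q = ennreal (measure lborel Q)"
      by (intro emeasure_eq_ennreal_measure) auto
    let ?I = "\<lambda>r. \<integral>\<^sup>+x. ennreal (\<bar>v x - mean Q v\<bar> powr r) * indicator Q x \<partial>lborel"
    \<comment> \<open>The energy controls the exponent p; on the single cube Q the exponent is
      lowered to q.\<close>
    have "?I q \<le> ennreal (2 * measure lborel Q * (C1 * e v Q) powr q)"
    proof -
      have "?I r = (\<integral>\<^sup>+x. ennreal (\<bar>v x - mean Q v\<bar> powr r) \<partial>restrict_space lborel Q)" for r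
        by (simp add: nn_integral_restrict_space)
      moreover have "(\<integral>\<^sup>+x. ennreal (\<bar>v x - mean Q v\<bar> powr q) \<partial>restrict_space lborel Q)
        \<le> ennreal (2 * measure lborel Q * (C1 * e v Q) powr q)"
      proof (rule nn_integral_powr_exponent_le[OF _ _ q])
        show "(\<lambda>x. \<bar>v x - mean Q v\<bar>) \<in> borel_measurable (restrict_space lborel Q)"
          using v(1) by (intro measurable_restrict_space1 borel_measurable_abs borel_measurable_diff) auto
        show "(\<integral>\<^sup>+x. ennreal (\<bar>v x - mean Q v\<bar> powr p) \<partial>restrict_space lborel Q)
            \<le> ennreal (measure lborel Q * (C1 * e v Q) powr p)"
          using dev[OF v Q E_finite[OF fin Q]] by (simp add: nn_integral_restrict_space)
      qed (use Qe C1 e_nonneg[of v Q] in \<open>simp_all add: emeasure_restrict_space\<close>)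
      ultimately show ?thesis by simp
    qed
    also have "\<dots> \<le> ennreal (2 * measure lborel Q * (C1 * T) powr q)"
      using eQ C1 e_nonneg[of v Q] q by (intro ennreal_leI mult_left_mono powr_mono2) auto
    finally have Iq: "?I q \<le> ennreal (2 * measure lborel Q * (C1 * T) powr q)" .
    have "(\<integral>\<^sup>+x. ennreal (\<bar>v x - mean Q0 v\<bar> powr q) * indicator Q x \<partial>lborel)
      \<le> (\<integral>\<^sup>+x. ennreal (2 powr q) * (ennreal (\<bar>v x - mean Q v\<bar> powr q) * indicator Q x
          + ennreal ((4 * C2 * T) powr q) * indicator Q x) \<partial>lborel)"
    proof (rule nn_integral_mono)
      fix x
      have "\<bar>v x - mean Q0 v\<bar> powr q \<le> (\<bar>v x - mean Q v\<bar> + 4 * C2 * T) powr q"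
        using mm q by (intro powr_mono2) auto
      also have "\<dots> \<le> 2 powr q * (\<bar>v x - mean Q v\<bar> powr q + (4 * C2 * T) powr q)"
        by (rule powr_sum2_le) (use T C2 q in auto)
      finally have "ennreal (\<bar>v x - mean Q0 v\<bar> powr q)
          \<le> ennreal (2 powr q) * (ennreal (\<bar>v x - mean Q v\<bar> powr q) + ennreal ((4 * C2 * T) powr q))"
        by (simp flip: ennreal_mult ennreal_plus)
      then show "ennreal (\<bar>v x - mean Q0 v\<bar> powr q) * indicator Q x \<le> ennreal (2 powr q) *
          (ennreal (\<bar>v x - mean Q v\<bar> powr q) * indicator Q x + ennreal ((4 * C2 * T) powr q) * indicator Q x)"
        by (auto simp: indicator_def)
    qed
    also have "\<dots> = ennreal (2 powr q) * (?I q + ennreal ((4 * C2 * T) powr q) * ennreal (measure lborel Q))"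
      using v by (simp add: nn_integral_cmult nn_integral_add Qe)
    also have "\<dots> \<le> ennreal (2 powr q) * (ennreal (2 * measure lborel Q * (C1 * T) powr q)
        + ennreal ((4 * C2 * T) powr q) * ennreal (measure lborel Q))"
      by (intro mult_left_mono add_right_mono Iq) auto
    also have "\<dots> = ennreal (2 powr q * (2 * measure lborel Q * (C1 * T) powr q + (4 * C2 * T) powr q * measure lborel Q))"
      by (simp flip: ennreal_mult ennreal_plus)
    also have "2 powr q * (2 * measure lborel Q * (C1 * T) powr q + (4 * C2 * T) powr q * measure lborel Q)
        = C * measure lborel Q * T powr q"
      using T C1 C2 by (simp add: C_def powr_mult algebra_simps)
    finally show "(\<integral>\<^sup>+x. ennreal (\<bar>v x - mean Q0 v\<bar> powr q) * indicator Q x \<partial>lborel)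
        \<le> ennreal (C * measure lborel Q * (\<Sum>A\<in>set (Ch Q). e v A) powr q)"
      by (simp add: T_def xs_def)
  qed
qed

text \<open>A chain of length 0 carries the weight 0 when q > 1; this happens only for Q = Q0, which is
  accounted for separately.\<close>

lemma chain_sum_powr_le:
  assumes q: "1 \<le> q" and ch: "chain_decomposition W Q0 Ch" and Q: "Q \<in> W"
  shows "(\<Sum>A\<in>set (Ch Q). e v A) powr q \<le>
    4 powr q * (pow0 (real (chain_length (Ch Q))) (q - 1) * (\<Sum>A\<in>set (Ch Q). e v A powr q)
      + (if Q = Q0 then e v Q0 powr q else 0))"
proof (cases "chain_length (Ch Q) = 0")
  case True
  note ch = chain_decompositionD[OF ch Q]
  obtain B where B: "Ch Q = [B]"
    using True ch(2) by (cases "Ch Q") (auto simp: chain_length_def)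
  then have "Q = Q0" "B = Q0" using ch(3,4) by auto
  have "e v Q0 powr q \<le> 4 powr q * e v Q0 powr q"
    using mult_right_mono[of 1 "4 powr q" "e v Q0 powr q"] ge_one_powr_ge_zero[of 4 q] q by simp
  \<comment> \<open>\<open>pow0 0 (q - 1)\<close> is 1 for q = 1 and 0 for q > 1; in both cases its
    term is nonnegative and may be added.\<close>
  also have "\<dots> \<le> 4 powr q * (pow0 0 (q - 1) * e v Q0 powr q + e v Q0 powr q)"
    by (intro mult_left_mono) (auto simp: pow0_def)
  finally show ?thesis using \<open>Q = Q0\<close> \<open>B = Q0\<close> B True by simp
next
  case False
  note ch = chain_decompositionD[OF ch Q]
  define k where "k = real (chain_length (Ch Q))"
  have k: "k \<ge> 1" using False by (simp add: k_def)
  have "card (set (Ch Q)) \<le> length (Ch Q)" by (rule card_length)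
  \<comment> \<open>A chain of length k has k + 1 entries, and k \<ge> 1 turns k + 1 into at most
    2k, so that a power of k itself remains.\<close>
  then have "real (card (set (Ch Q))) \<le> k + 1" using ch(2) by (simp add: k_def chain_length_def)
  then have "(\<Sum>A\<in>set (Ch Q). e v A) powr q \<le> 2 powr q * (2 * k) powr (q - 1) * (\<Sum>A\<in>set (Ch Q). e v A powr q)"
    using ch(2) k q by (intro sum_powr_le) (auto simp: e_nonneg)
  also have "2 powr q * (2 * k) powr (q - 1) \<le> 4 powr q * pow0 k (q - 1)"
  proof -
    have "2 powr q * (2 * k) powr (q - 1) = 2 powr q * 2 powr (q - 1) * k powr (q - 1)"
      using k by (simp add: powr_mult)
    also have "\<dots> \<le> 2 powr q * 2 powr q * k powr (q - 1)"
      by (intro mult_left_mono mult_right_mono powr_mono) auto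
    also have "2 powr q * 2 powr q = (4::real) powr q" by (simp flip: powr_mult)
    also have "k powr (q - 1) = pow0 k (q - 1)" using k by (simp add: pow0_def)
    finally show ?thesis .
  qed
  finally show ?thesis
    by (auto simp: k_def distrib_left sum_nonneg mult_right_mono intro: order_trans)
qed

end

section \<open>Summation over the Whitney cubes\<close>

text \<open>Completion does not change the integral of a nonnegative function, measurable or not, so
  the rule can be applied to the iterated integral of u as it stands.\<close>

lemma nn_integral_lebesgue_on:
  assumes "S \<in> sets lebesgue"
  shows "(\<integral>\<^sup>+x. f x \<partial>lebesgue_on S) = (\<integral>\<^sup>+x. f x * indicator S x \<partial>lborel)"
  using assms by (simp add: nn_integral_restrict_space nn_integral_completion)

context whitney_frac
begin

lemma W_borel: "A \<in> W \<Longrightarrow> A \<in> sets borel"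
  by (metis W_rep dyadic_repD(1) cube_borel)

lemma measure_lebesgue_W: "A \<in> W \<Longrightarrow> measure lebesgue A = measure lborel A"
  by (simp add: W_borel measure_completion)

lemma emeasure_G: "emeasure lborel G < \<infinity>" "0 < measure lborel G"
proof -
  show fin: "emeasure lborel G < \<infinity>" using emeasure_bounded_finite[OF bounded_G] by simp
  obtain A where A: "A \<in> W" using G_nonempty Union_W by blast
  obtain a s where r: "dyadic_rep A a s" using W_rep[OF A] .
  have "0 < measure lborel A" using measure_rep[OF r] dyadic_repD(2)[OF r] by simp
  also have "\<dots> \<le> measure lborel G"
    using W_subset[OF A] W_borel[OF A] fin by (intro measure_mono_fmeasurable) (auto simp: fmeasurable_def)
  finally show "0 < measure lborel G" .
qed

text \<open>The mean over G may be replaced by any constant m: by \<open>mean_deviation_set\<close>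
  on G, |m - uG|^q |G| is at most 2 powr q times the integral of |v - m|^q. The chains can thus be
  anchored at the mean over Q0.\<close>

lemma fractional_poincareI:
  assumes q: "1 \<le> q" "q \<le> p" and K: "0 \<le> K"
    and est: "\<And>v. v \<in> borel_measurable borel \<Longrightarrow> set_integrable lborel G v \<Longrightarrow> E v G < \<infinity> \<Longrightarrow>
      \<exists>m. (\<integral>\<^sup>+x. ennreal (\<bar>v x - m\<bar> powr q) * indicator G x \<partial>lborel)
        \<le> ennreal (K * enn2real (E v G) powr (q / p))"
  shows "fractional_poincare G q p \<delta> \<tau>"
  unfolding fractional_poincare_def Let_def
\<comment> \<open>The outer 2 powr q splits |v - uG|; in the bracket, 1 stands for |v - m| and 2
  powr q for |m - uG|.\<close>
proof (intro exI[of _ "2 powr q * (1 + 2 powr q) * K"] allI impI)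
  fix u :: "real^'n \<Rightarrow> real"
  assume um: "u \<in> borel_measurable (lebesgue_on G)"
    and ui: "integrable (lebesgue_on G) (\<lambda>x. \<bar>u x\<bar> powr p)"
  define D where "D = (\<integral>\<^sup>+ x. (\<integral>\<^sup>+ y. ennreal (\<bar>u x - u y\<bar> powr p / dist x y powr (real CARD('n) + \<delta> * p))
                   \<partial>lebesgue_on (G \<inter> ball x (\<tau> * infdist x (frontier G)))) \<partial>lebesgue_on G)"
  define uG where "uG = (\<integral>x. u x \<partial>lebesgue_on G) / measure lebesgue G"
  assume "(\<integral>\<^sup>+ x. (\<integral>\<^sup>+ y. ennreal (\<bar>u x - u y\<bar> powr p / dist x y powr (real CARD('n) + \<delta> * p))
                   \<partial>lebesgue_on (G \<inter> ball x (\<tau> * infdist x (frontier G)))) \<partial>lebesgue_on G) < \<infinity>"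
  then have D: "D < \<infinity>" by (simp add: D_def)
  have Gl: "G \<in> sets lebesgue" using G_borel by simp
  \<comment> \<open>Extended by zero, u is Lebesgue measurable on the whole space and so agrees
    almost everywhere with a Borel function.\<close>
  have "(\<lambda>x. if x \<in> G then u x else 0) \<in> borel_measurable (completion lborel)"
    using um Gl by (rule borel_measurable_if_I)
  then obtain v where v: "v \<in> borel_measurable lborel" and "AE x in lborel. (if x \<in> G then u x else 0) = v x"
    using completion_ex_borel_measurable_real by blast
  then have ae: "AE x in lborel. x \<in> G \<longrightarrow> u x = v x"
    by (auto elim!: eventually_mono)
  have vb [measurable]: "v \<in> borel_measurable borel" using v by simp
  have ED: "D = E v G"
  proof -
    have "D = (\<integral>\<^sup>+ x. (\<integral>\<^sup>+ y. ennreal (\<bar>u x - u y\<bar> powr p / dist x y powr (real CARD('n) + \<delta> * p))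
        * indicator (G \<inter> ball x (\<tau> * infdist x (frontier G))) y \<partial>lborel) * indicator G x \<partial>lborel)"
      unfolding D_def by (simp add: nn_integral_lebesgue_on Gl sets.Int)
    also have "\<dots> = E v G"
      unfolding energy_def gagliardo_def
    \<comment> \<open>The agreement almost everywhere is used twice: for the outer variable, and for
      the inner one with the outer fixed.\<close>
    proof (rule nn_integral_cong_AE, use ae in eventually_elim)
      case (elim x)
      have "(\<integral>\<^sup>+ y. ennreal (\<bar>u x - u y\<bar> powr p / dist x y powr (real CARD('n) + \<delta> * p))
          * indicator (G \<inter> ball x (\<tau> * infdist x (frontier G))) y \<partial>lborel)
        = (\<integral>\<^sup>+ y. ennreal (\<bar>v x - v y\<bar> powr p / dist x y powr (real CARD('n) + \<delta> * p))
          * indicator (G \<inter> ball x (\<tau> * infdist x (frontier G))) y \<partial>lborel)" if "x \<in> G"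
        by (rule nn_integral_cong_AE, use ae in eventually_elim) (use elim that in \<open>auto simp: indicator_def\<close>)
      then show ?case by (auto simp: indicator_def)
    qed
    finally show ?thesis .
  qed
  have int: "set_integrable lborel G v"
    unfolding set_integrable_def
  proof (rule integrableI_bounded)
    show "(\<lambda>x. indicator G x *\<^sub>R v x) \<in> borel_measurable lborel" by simp
    \<comment> \<open>As G has finite measure, |v| \<le> 1 + |v|^p gives integrability from the p-th
      power.\<close>
    have "(\<integral>\<^sup>+x. ennreal (norm (indicator G x *\<^sub>R v x)) \<partial>lborel)
        \<le> (\<integral>\<^sup>+x. indicator G x + ennreal (\<bar>v x\<bar> powr p) * indicator G x \<partial>lborel)"
    proof (rule nn_integral_mono)
      fix x
      show "ennreal (norm (indicator G x *\<^sub>R v x)) \<le> indicator G x + ennreal (\<bar>v x\<bar> powr p) * indicator G x"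
      proof (cases "x \<in> G")
        case True
        have "ennreal \<bar>v x\<bar> \<le> ennreal (1 + \<bar>v x\<bar> powr p)"
          using le_add_powr[of "\<bar>v x\<bar>" 1 1 p] p by (intro ennreal_leI) simp
        then show ?thesis using True by simp
      qed simp
    qed
    also have "\<dots> = emeasure lborel G + (\<integral>\<^sup>+x. ennreal (\<bar>v x\<bar> powr p) * indicator G x \<partial>lborel)"
      by (subst nn_integral_add) auto
    also have "(\<integral>\<^sup>+x. ennreal (\<bar>v x\<bar> powr p) * indicator G x \<partial>lborel)
        = (\<integral>\<^sup>+x. ennreal (\<bar>u x\<bar> powr p) * indicator G x \<partial>lborel)"
      by (rule nn_integral_cong_AE, use ae in eventually_elim) (auto simp: indicator_def)
    also have "\<dots> = (\<integral>\<^sup>+x. ennreal (norm (\<bar>u x\<bar> powr p)) \<partial>lebesgue_on G)"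
      by (simp add: nn_integral_lebesgue_on Gl)
    finally show "(\<integral>\<^sup>+x. ennreal (norm (indicator G x *\<^sub>R v x)) \<partial>lborel) < \<infinity>"
      using emeasure_G(1) ui unfolding integrable_iff_bounded
      by (auto simp: order.strict_iff_not top_unique)
  qed
  have uG: "uG = mean G v"
  proof -
    have "(\<integral>x. u x \<partial>lebesgue_on G) = (\<integral>x. indicator G x *\<^sub>R u x \<partial>lebesgue)"
      using Gl by (simp add: integral_restrict_space)
    also have "\<dots> = (\<integral>x. indicator G x *\<^sub>R v x \<partial>lebesgue)"
    proof (rule integral_cong_AE)
      show "(\<lambda>x. indicator G x *\<^sub>R u x) \<in> borel_measurable lebesgue"
      proof -
        have "(\<lambda>x. indicator G x *\<^sub>R u x) = (\<lambda>x. if x \<in> G then u x else 0)" by auto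
        then show ?thesis using borel_measurable_if_I[OF um Gl] by simp
      qed
      show "(\<lambda>x. indicator G x *\<^sub>R v x) \<in> borel_measurable lebesgue"
        by (intro measurable_completion) simp
      show "AE x in lebesgue. indicator G x *\<^sub>R u x = indicator G x *\<^sub>R v x"
        by (rule AE_completion, use ae in eventually_elim) (auto simp: indicator_def)
    qed
    also have "\<dots> = (LINT x:G|lborel. v x)"
      unfolding set_lebesgue_integral_def by (rule integral_completion) simp
    finally show ?thesis by (simp add: uG_def mean_def measure_completion)
  qed
  obtain m where m: "(\<integral>\<^sup>+x. ennreal (\<bar>v x - m\<bar> powr q) * indicator G x \<partial>lborel)
        \<le> ennreal (K * enn2real (E v G) powr (q / p))" (is "?J \<le> _")
    using est[OF vb int] D ED by blast
  have J': "(\<integral>\<^sup>+x. ennreal (\<bar>m - v x\<bar> powr q) * indicator G x \<partial>lborel) = ?J"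
    by (simp add: abs_minus_commute)
  have md: "ennreal (\<bar>m - uG\<bar> powr q) \<le> ennreal (2 powr q / measure lborel G) * ?J"
    using mean_deviation_set[OF G_borel emeasure_G int q(1), of m] unfolding uG J' .
  have Ge: "emeasure lborel G = ennreal (measure lborel G)"
    using emeasure_G(1) by (intro emeasure_eq_ennreal_measure) auto
  have "(\<integral>\<^sup>+ x. ennreal (\<bar>u x - uG\<bar> powr q) \<partial>lebesgue_on G)
      = (\<integral>\<^sup>+ x. ennreal (\<bar>v x - uG\<bar> powr q) * indicator G x \<partial>lborel)"
    unfolding nn_integral_lebesgue_on[OF Gl]
    by (rule nn_integral_cong_AE, use ae in eventually_elim) (auto simp: indicator_def)
  also have "\<dots> \<le> (\<integral>\<^sup>+ x. ennreal (2 powr q) * (ennreal (\<bar>v x - m\<bar> powr q) * indicator G x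
      + ennreal (\<bar>m - uG\<bar> powr q) * indicator G x) \<partial>lborel)"
  proof (rule nn_integral_mono)
    fix x
    have "\<bar>v x - uG\<bar> powr q \<le> (\<bar>v x - m\<bar> + \<bar>m - uG\<bar>) powr q"
      using q by (intro powr_mono2) auto
    also have "\<dots> \<le> 2 powr q * (\<bar>v x - m\<bar> powr q + \<bar>m - uG\<bar> powr q)"
      by (rule powr_sum2_le) (use q in auto)
    finally have "ennreal (\<bar>v x - uG\<bar> powr q)
        \<le> ennreal (2 powr q) * (ennreal (\<bar>v x - m\<bar> powr q) + ennreal (\<bar>m - uG\<bar> powr q))"
      by (simp flip: ennreal_mult ennreal_plus)
    then show "ennreal (\<bar>v x - uG\<bar> powr q) * indicator G x \<le> ennreal (2 powr q) *
        (ennreal (\<bar>v x - m\<bar> powr q) * indicator G x + ennreal (\<bar>m - uG\<bar> powr q) * indicator G x)"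
      by (auto simp: indicator_def)
  qed
  also have "\<dots> = ennreal (2 powr q) * (?J + ennreal (\<bar>m - uG\<bar> powr q) * ennreal (measure lborel G))"
    by (simp add: nn_integral_cmult nn_integral_add Ge)
  also have "\<dots> \<le> ennreal (2 powr q) * (?J + ennreal (2 powr q / measure lborel G) * ?J * ennreal (measure lborel G))"
    by (intro mult_left_mono add_left_mono mult_right_mono md) auto
  also have "ennreal (2 powr q / measure lborel G) * ?J * ennreal (measure lborel G)
      = ennreal (2 powr q / measure lborel G * measure lborel G) * ?J"
    using emeasure_G(2) by (simp only: ennreal_mult divide_nonneg_nonneg powr_ge_zero measure_nonneg ac_simps)
  also have "2 powr q / measure lborel G * measure lborel G = 2 powr q" using emeasure_G(2) by simp
  also have "ennreal (2 powr q) * (?J + ennreal (2 powr q) * ?J) = ennreal (2 powr q * (1 + 2 powr q)) * ?J"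
    by (simp add: ennreal_mult distrib_left distrib_right mult.assoc)
  also have "\<dots> \<le> ennreal (2 powr q * (1 + 2 powr q)) * ennreal (K * enn2real (E v G) powr (q / p))"
    by (intro mult_left_mono m) auto
  also have "\<dots> = ennreal (2 powr q * (1 + 2 powr q) * K) * ennreal (enn2real D powr (q / p))"
    using K by (simp add: ED ennreal_mult mult.assoc)
  finally show "(\<integral>\<^sup>+ x. ennreal (\<bar>u x - (\<integral>x. u x \<partial>lebesgue_on G) / measure lebesgue G\<bar> powr q) \<partial>lebesgue_on G)
    \<le> ennreal (2 powr q * (1 + 2 powr q) * K) * ennreal (enn2real
      (\<integral>\<^sup>+ x. (\<integral>\<^sup>+ y. ennreal (\<bar>u x - u y\<bar> powr p / dist x y powr (real CARD('n) + \<delta> * p))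
                   \<partial>lebesgue_on (G \<inter> ball x (\<tau> * infdist x (frontier G)))) \<partial>lebesgue_on G) powr (q / p))"
    unfolding D_def uG_def .
qed

section \<open>Exchange of the sums over cubes and chains\<close>

definition shadow_weight :: "real \<Rightarrow> ((real^'n) set \<Rightarrow> (real^'n) set list) \<Rightarrow> (real^'n) set \<Rightarrow> (real^'n) set \<Rightarrow> real" where
  "shadow_weight q Ch A Q = pow0 (real (chain_length (Ch Q))) (q - 1) * measure lebesgue Q
      * measure lebesgue A powr (q * (\<delta> / real CARD('n) - 1 / p))"

lemma shadow_weight_nonneg: "0 \<le> shadow_weight q Ch A Q"
  by (simp add: shadow_weight_def pow0_def)

lemma e_powr_q: "e v A powr q = measure lborel A powr (q * (\<delta> / real CARD('n) - 1 / p)) * enn2real (E v A) powr (q / p)"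
  by (simp add: e_def powr_mult powr_powr mult.commute)

lemma e_powr_q_le:
  assumes "0 \<le> q" "E v G < \<infinity>" "A \<in> W"
  shows "e v A powr q \<le> measure lborel A powr (q * (\<delta> / real CARD('n) - 1 / p)) * enn2real (E v G) powr (q / p)"
  unfolding e_powr_q
  using assms p energy_mono[OF W_subset[OF assms(3)]]
  by (intro mult_left_mono powr_mono2 enn2real_mono) auto

text \<open>Tonelli for counting measures: instead of summing over the cubes A of each chain, fix A
  and sum over the Q whose chain contains it. By \<open>e_powr_q\<close> the energy of A then
  factors out of the inner sum.\<close>

lemma sum_over_chains_le:
  assumes ch: "chain_decomposition W Q0 Ch" and q: "1 \<le> q"
    and sm: "\<And>A. A \<in> W \<Longrightarrow> shadow_weight q Ch A summable_on shadow W Ch A"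
  shows "(\<integral>\<^sup>+Q. ennreal (pow0 (real (chain_length (Ch Q))) (q - 1) * measure lborel Q
        * (\<Sum>A\<in>set (Ch Q). e v A powr q)) \<partial>count_space W)
    \<le> (\<integral>\<^sup>+A. ennreal ((\<Sum>\<^sub>\<infinity>Q\<in>shadow W Ch A. shadow_weight q Ch A Q) * enn2real (E v A) powr (q / p)) \<partial>count_space W)"
proof -
  let ?w = "\<lambda>Q. pow0 (real (chain_length (Ch Q))) (q - 1) * measure lborel Q"
  let ?F = "\<lambda>A Q. if A \<in> set (Ch Q) then ennreal (?w Q * e v A powr q) else 0"
  have w: "?w Q \<ge> 0" for Q by (simp add: pow0_def)
  have "ennreal (?w Q * (\<Sum>A\<in>set (Ch Q). e v A powr q)) = (\<integral>\<^sup>+A. ?F A Q \<partial>count_space W)" if "Q \<in> W" for Q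
  proof -
    have "(\<integral>\<^sup>+A. ?F A Q \<partial>count_space W) = (\<Sum>A\<in>set (Ch Q). ?F A Q)"
      using chain_decompositionD(5)[OF ch that] by (intro nn_integral_count_space') auto
    also have "\<dots> = (\<Sum>A\<in>set (Ch Q). ennreal (?w Q * e v A powr q))" by simp
    also have "\<dots> = ennreal (\<Sum>A\<in>set (Ch Q). ?w Q * e v A powr q)"
      using w by (intro sum_ennreal) simp
    finally show ?thesis by (simp add: sum_distrib_left)
  qed
  then have "(\<integral>\<^sup>+Q. ennreal (?w Q * (\<Sum>A\<in>set (Ch Q). e v A powr q)) \<partial>count_space W)
      = (\<integral>\<^sup>+Q. (\<integral>\<^sup>+A. ?F A Q \<partial>count_space W) \<partial>count_space W)"
    by (intro nn_integral_cong) simp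
  also have "\<dots> = (\<integral>\<^sup>+A. (\<integral>\<^sup>+Q. ?F A Q \<partial>count_space W) \<partial>count_space W)"
    by (intro nn_integral_count_space_nn_integral countable_W) simp
  also have "\<dots> \<le> (\<integral>\<^sup>+A. ennreal ((\<Sum>\<^sub>\<infinity>Q\<in>shadow W Ch A. shadow_weight q Ch A Q) * enn2real (E v A) powr (q / p)) \<partial>count_space W)"
  proof (rule nn_integral_mono)
    fix A assume "A \<in> space (count_space W)"
    then have A: "A \<in> W" by simp
    have sub: "shadow W Ch A \<subseteq> W" by (auto simp: shadow_def)
    \<comment> \<open>The shadow is defined through stars; A in \<open>set (Ch Q)\<close> puts Q
      into it, so the terms outside the shadow vanish.\<close>
    have "(\<integral>\<^sup>+Q. ?F A Q \<partial>count_space W) = (\<integral>\<^sup>+Q. ?F A Q \<partial>count_space (shadow W Ch A))"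
      by (rule nn_integral_count_space_eq) (auto simp: shadow_def)
    also have "\<dots> \<le> (\<integral>\<^sup>+Q. ennreal (shadow_weight q Ch A Q) * ennreal (enn2real (E v A) powr (q / p)) \<partial>count_space (shadow W Ch A))"
      by (intro nn_integral_mono)
         (use A sub in \<open>auto simp: shadow_weight_def e_powr_q measure_lebesgue_W[OF A]
           measure_lebesgue_W[OF subsetD[OF sub]] pow0_def mult.assoc simp flip: ennreal_mult\<close>)
    also have "\<dots> = (\<integral>\<^sup>+Q. ennreal (shadow_weight q Ch A Q) \<partial>count_space (shadow W Ch A)) * ennreal (enn2real (E v A) powr (q / p))"
      by (rule nn_integral_multc) simp
    also have "(\<integral>\<^sup>+Q. ennreal (shadow_weight q Ch A Q) \<partial>count_space (shadow W Ch A))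
        = ennreal (\<Sum>\<^sub>\<infinity>Q\<in>shadow W Ch A. shadow_weight q Ch A Q)"
      by (rule nn_integral_count_space_infsum[OF sm[OF A] shadow_weight_nonneg])
    finally show "(\<integral>\<^sup>+Q. ?F A Q \<partial>count_space W)
        \<le> ennreal ((\<Sum>\<^sub>\<infinity>Q\<in>shadow W Ch A. shadow_weight q Ch A Q) * enn2real (E v A) powr (q / p))"
      by (simp add: ennreal_mult infsum_nonneg shadow_weight_nonneg)
  qed
  finally show ?thesis .
qed

text \<open>After the geometry an inequality for families indexed by W remains, isolated as
  \<open>H\<close>: \<open>x A\<close> stands for the energy of A and \<open>D\<close> for the total
  energy. Its proof is what distinguishes q < p from q = p.\<close>

lemma poincare_of_shadow_sums:
  assumes ch: "chain_decomposition W Q0 Ch" and q: "1 \<le> q" "q \<le> p"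
    and sm: "\<And>A. A \<in> W \<Longrightarrow> shadow_weight q Ch A summable_on shadow W Ch A"
    and K: "0 \<le> K"
    and H: "\<And>x D. (\<And>A. 0 \<le> x A) \<Longrightarrow> 0 \<le> D \<Longrightarrow> (\<integral>\<^sup>+A. ennreal (x A) \<partial>count_space W) \<le> ennreal D \<Longrightarrow>
      (\<integral>\<^sup>+A. ennreal ((\<Sum>\<^sub>\<infinity>Q\<in>shadow W Ch A. shadow_weight q Ch A Q) * x A powr (q / p)) \<partial>count_space W)
        \<le> ennreal (K * D powr (q / p))"
  shows "fractional_poincare G q p \<delta> \<tau>"
proof -
  obtain C where C: "C > 0" and cube: "\<And>v Q. v \<in> borel_measurable borel \<Longrightarrow>
      set_integrable lborel G v \<Longrightarrow> E v G < \<infinity> \<Longrightarrow> Q \<in> W \<Longrightarrow>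
      (\<integral>\<^sup>+x. ennreal (\<bar>v x - mean Q0 v\<bar> powr q) * indicator Q x \<partial>lborel)
        \<le> ennreal (C * measure lborel Q * (\<Sum>A\<in>set (Ch Q). e v A) powr q)"
    using chain_estimate[OF q] ch by blast
  have Q0: "Q0 \<in> W" using ch by (simp add: chain_decomposition_def)
  \<comment> \<open>The constant for the extra term of \<open>chain_sum_powr_le\<close>: at the
    single cube Q0 the local energy is simply bounded by the full one.\<close>
  define K0 where "K0 = measure lborel Q0 * measure lborel Q0 powr (q * (\<delta> / real CARD('n) - 1 / p))"
  have K0: "K0 \<ge> 0" by (simp add: K0_def)
  define c where "c = C * 4 powr q"
  have c: "c \<ge> 0" using C by (simp add: c_def)
  show ?thesis
  proof (rule fractional_poincareI[OF q])
    show "0 \<le> c * (K + K0)" using c K K0 by simp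
    fix v :: "real^'n \<Rightarrow> real"
    assume v: "v \<in> borel_measurable borel" "set_integrable lborel G v" and fin: "E v G < \<infinity>"
    define D where "D = enn2real (E v G)"
    let ?m = "mean Q0 v"
    let ?t = "\<lambda>Q. pow0 (real (chain_length (Ch Q))) (q - 1) * measure lborel Q * (\<Sum>A\<in>set (Ch Q). e v A powr q)"
    let ?r = "\<lambda>Q. if Q = Q0 then measure lborel Q0 * e v Q0 powr q else 0"
    have t: "0 \<le> ?t Q" for Q by (simp add: pow0_def sum_nonneg)
    \<comment> \<open>The cubes cover G, and counting shared boundary points several times only
      enlarges the right-hand side.\<close>
    have "(\<integral>\<^sup>+x. ennreal (\<bar>v x - ?m\<bar> powr q) * indicator G x \<partial>lborel)
        \<le> (\<integral>\<^sup>+x. (\<integral>\<^sup>+Q. ennreal (\<bar>v x - ?m\<bar> powr q) * indicator Q x \<partial>count_space W) \<partial>lborel)"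
    proof (rule nn_integral_mono)
      fix x
      show "ennreal (\<bar>v x - ?m\<bar> powr q) * indicator G x
          \<le> (\<integral>\<^sup>+Q. ennreal (\<bar>v x - ?m\<bar> powr q) * indicator Q x \<partial>count_space W)"
      proof (cases "x \<in> G")
        case True
        then obtain Q where "Q \<in> W" "x \<in> Q" using Union_W by blast
        then show ?thesis
          using nn_integral_ge_point[of Q W "\<lambda>Q. ennreal (\<bar>v x - ?m\<bar> powr q) * indicator Q x"] True by simp
      qed simp
    qed
    also have "\<dots> = (\<integral>\<^sup>+Q. (\<integral>\<^sup>+x. ennreal (\<bar>v x - ?m\<bar> powr q) * indicator Q x \<partial>lborel) \<partial>count_space W)"
    proof (intro nn_integral_count_space_nn_integral countable_W)
      fix Q assume "Q \<in> W"
      note [measurable] = W_borel[OF this] v(1)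
      show "(\<lambda>x. ennreal (\<bar>v x - ?m\<bar> powr q) * indicator Q x) \<in> borel_measurable lborel" by measurable
    qed
    also have "\<dots> \<le> (\<integral>\<^sup>+Q. ennreal c * (ennreal (?t Q) + ennreal (?r Q)) \<partial>count_space W)"
    proof (rule nn_integral_mono)
      fix Q assume "Q \<in> space (count_space W)"
      then have Q: "Q \<in> W" by simp
      have "C * measure lborel Q * (\<Sum>A\<in>set (Ch Q). e v A) powr q
          \<le> C * measure lborel Q * (4 powr q * (pow0 (real (chain_length (Ch Q))) (q - 1) * (\<Sum>A\<in>set (Ch Q). e v A powr q)
            + (if Q = Q0 then e v Q0 powr q else 0)))"
        using C by (intro mult_left_mono chain_sum_powr_le q ch Q) auto
      also have "\<dots> = c * (?t Q + ?r Q)"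
        by (simp add: c_def algebra_simps)
      finally have "ennreal (C * measure lborel Q * (\<Sum>A\<in>set (Ch Q). e v A) powr q) \<le> ennreal c * (ennreal (?t Q) + ennreal (?r Q))"
        using c t[of Q] by (simp flip: ennreal_mult ennreal_plus)
      then show "(\<integral>\<^sup>+x. ennreal (\<bar>v x - ?m\<bar> powr q) * indicator Q x \<partial>lborel) \<le> ennreal c * (ennreal (?t Q) + ennreal (?r Q))"
        using cube[OF v fin Q] by (rule order_trans[rotated])
    qed
    also have "\<dots> = ennreal c * ((\<integral>\<^sup>+Q. ennreal (?t Q) \<partial>count_space W) + (\<integral>\<^sup>+Q. ennreal (?r Q) \<partial>count_space W))"
      by (simp add: nn_integral_cmult nn_integral_add)
    also have "\<dots> \<le> ennreal c * (ennreal (K * D powr (q / p)) + ennreal (K0 * D powr (q / p)))"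
    proof (intro mult_left_mono add_mono)
      have "(\<integral>\<^sup>+A. ennreal (enn2real (E v A)) \<partial>count_space W) = (\<integral>\<^sup>+A. E v A \<partial>count_space W)"
        by (intro nn_integral_cong) (use E_finite[OF fin] in auto)
      also have "\<dots> \<le> ennreal D" using sum_energy_le[OF v(1)] fin by (simp add: D_def)
      finally have "(\<integral>\<^sup>+A. ennreal ((\<Sum>\<^sub>\<infinity>Q\<in>shadow W Ch A. shadow_weight q Ch A Q) * enn2real (E v A) powr (q / p)) \<partial>count_space W)
        \<le> ennreal (K * D powr (q / p))"
        by (intro H) (auto simp: D_def)
      then show "(\<integral>\<^sup>+Q. ennreal (?t Q) \<partial>count_space W) \<le> ennreal (K * D powr (q / p))"
        using sum_over_chains_le[OF ch q(1) sm] by (rule order_trans[rotated])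
      have "(\<integral>\<^sup>+Q. ennreal (?r Q) \<partial>count_space W) = (\<Sum>Q\<in>{Q0}. ennreal (?r Q))"
        using Q0 by (intro nn_integral_count_space') auto
      also have "\<dots> \<le> ennreal (K0 * D powr (q / p))"
        using mult_left_mono[OF e_powr_q_le[OF _ fin Q0], of q "measure lborel Q0"] q
        by (simp add: K0_def D_def mult.assoc)
      finally show "(\<integral>\<^sup>+Q. ennreal (?r Q) \<partial>count_space W) \<le> ennreal (K0 * D powr (q / p))" .
    qed auto
    also have "\<dots> = ennreal (c * (K + K0) * D powr (q / p))"
      using c K K0 by (simp add: algebra_simps flip: ennreal_mult ennreal_plus)
    finally show "\<exists>m. (\<integral>\<^sup>+x. ennreal (\<bar>v x - m\<bar> powr q) * indicator G x \<partial>lborel)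
        \<le> ennreal (c * (K + K0) * enn2real (E v G) powr (q / p))"
      unfolding D_def by blast
  qed
qed

text \<open>Young's inequality in additive form is not homogeneous, so it is applied to
  \<open>x A / D\<close>. These quotients sum to at most 1, which explains K + 1. If D = 0, all
  \<open>x A\<close> with A in W vanish.\<close>

lemma poincare_subcritical:
  assumes ch: "chain_decomposition W Q0 Ch" and q: "1 \<le> q" "q < p"
    and sm: "\<And>A. A \<in> W \<Longrightarrow> shadow_weight q Ch A summable_on shadow W Ch A"
    and sum: "(\<lambda>A. (\<Sum>\<^sub>\<infinity>Q\<in>shadow W Ch A. shadow_weight q Ch A Q) powr (p / (p - q))) summable_on W"
  shows "fractional_poincare G q p \<delta> \<tau>"
proof -
  define S where "S A = (\<Sum>\<^sub>\<infinity>Q\<in>shadow W Ch A. shadow_weight q Ch A Q)" for A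
  have S: "0 \<le> S A" for A unfolding S_def by (intro infsum_nonneg shadow_weight_nonneg)
  define K where "K = (\<Sum>\<^sub>\<infinity>A\<in>W. S A powr (p / (p - q)))"
  have K: "0 \<le> K" unfolding K_def by (intro infsum_nonneg) simp
  have KS: "(\<integral>\<^sup>+A. ennreal (S A powr (p / (p - q))) \<partial>count_space W) = ennreal K"
    unfolding K_def by (rule nn_integral_count_space_infsum) (use sum in \<open>simp_all add: S_def\<close>)
  show ?thesis
  proof (rule poincare_of_shadow_sums[OF ch q(1) less_imp_le[OF q(2)] sm])
    show "0 \<le> K + 1" using K by simp
    fix x :: "(real^'n) set \<Rightarrow> real" and D :: real
    assume x: "\<And>A. 0 \<le> x A" and D: "0 \<le> D" and le: "(\<integral>\<^sup>+A. ennreal (x A) \<partial>count_space W) \<le> ennreal D"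
    have "(\<integral>\<^sup>+A. ennreal (S A * x A powr (q / p)) \<partial>count_space W) \<le> ennreal ((K + 1) * D powr (q / p))"
    proof (cases "D = 0")
      case True
      then have "(\<integral>\<^sup>+A. ennreal (x A) \<partial>count_space W) = 0" using le by simp
      then have "x A = 0" if "A \<in> W" for A
        using x[of A] that by (auto simp: nn_integral_0_iff_AE AE_count_space)
      then have "(\<integral>\<^sup>+A. ennreal (S A * x A powr (q / p)) \<partial>count_space W) = (\<integral>\<^sup>+A. 0 \<partial>count_space W)"
        by (intro nn_integral_cong) simp
      then show ?thesis by simp
    next
      case False
      then have D: "D > 0" using D by simp
      have "(\<integral>\<^sup>+A. ennreal (S A * x A powr (q / p)) \<partial>count_space W)
          \<le> (\<integral>\<^sup>+A. ennreal (D powr (q / p)) * (ennreal (S A powr (p / (p - q))) + ennreal (1 / D) * ennreal (x A)) \<partial>count_space W)"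
      proof (rule nn_integral_mono)
        fix A
        have "S A * x A powr (q / p) = D powr (q / p) * (S A * (x A / D) powr (q / p))"
          using D x by (simp add: powr_divide)
        also have "\<dots> \<le> D powr (q / p) * (S A powr (p / (p - q)) + 1 / D * x A)"
          using Young_powr[of "S A" "x A / D" q p] S x D q by (intro mult_left_mono) auto
        finally show "ennreal (S A * x A powr (q / p))
            \<le> ennreal (D powr (q / p)) * (ennreal (S A powr (p / (p - q))) + ennreal (1 / D) * ennreal (x A))"
          using D x by (simp flip: ennreal_mult ennreal_plus)
      qed
      also have "\<dots> = ennreal (D powr (q / p)) * (ennreal K + ennreal (1 / D) * (\<integral>\<^sup>+A. ennreal (x A) \<partial>count_space W))"
        by (simp add: nn_integral_cmult nn_integral_add KS)
      also have "\<dots> \<le> ennreal (D powr (q / p)) * (ennreal K + ennreal (1 / D) * ennreal D)"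
        by (intro mult_left_mono add_left_mono le) auto
      also have "\<dots> = ennreal ((K + 1) * D powr (q / p))"
        using D K by (simp add: mult.commute flip: ennreal_mult ennreal_plus ennreal_1)
      finally show ?thesis .
    qed
    then show "(\<integral>\<^sup>+A. ennreal ((\<Sum>\<^sub>\<infinity>Q\<in>shadow W Ch A. shadow_weight q Ch A Q) * x A powr (q / p)) \<partial>count_space W)
        \<le> ennreal ((K + 1) * D powr (q / p))" by (simp add: S_def)
  qed
qed

text \<open>For q = p the energies enter with exponent 1, so a uniform bound on the shadow sums can
  be taken out of the sum over A.\<close>

lemma poincare_critical:
  assumes ch: "chain_decomposition W Q0 Ch"
    and sm: "\<And>A. A \<in> W \<Longrightarrow> shadow_weight p Ch A summable_on shadow W Ch A"
    and bdd: "bdd_above ((\<lambda>A. \<Sum>\<^sub>\<infinity>Q\<in>shadow W Ch A. shadow_weight p Ch A Q) ` W)"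
  shows "fractional_poincare G p p \<delta> \<tau>"
proof -
  define S where "S A = (\<Sum>\<^sub>\<infinity>Q\<in>shadow W Ch A. shadow_weight p Ch A Q)" for A
  have S: "0 \<le> S A" for A unfolding S_def by (intro infsum_nonneg shadow_weight_nonneg)
  obtain M where M: "\<And>A. A \<in> W \<Longrightarrow> S A \<le> M" using bdd unfolding bdd_above_def S_def by auto
  define K where "K = max M 0"
  have K: "0 \<le> K" "\<And>A. A \<in> W \<Longrightarrow> S A \<le> K" using M by (auto simp: K_def max_def intro: order_trans)
  show ?thesis
  proof (rule poincare_of_shadow_sums[OF ch p order_refl sm K(1)])
    fix x :: "(real^'n) set \<Rightarrow> real" and D :: real
    assume x: "\<And>A. 0 \<le> x A" and D: "0 \<le> D" and le: "(\<integral>\<^sup>+A. ennreal (x A) \<partial>count_space W) \<le> ennreal D"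
    have "(\<integral>\<^sup>+A. ennreal (S A * x A powr (p / p)) \<partial>count_space W) \<le> (\<integral>\<^sup>+A. ennreal K * ennreal (x A) \<partial>count_space W)"
    proof (rule nn_integral_mono)
      fix A assume "A \<in> space (count_space W)"
      then show "ennreal (S A * x A powr (p / p)) \<le> ennreal K * ennreal (x A)"
        using K x p by (auto simp flip: ennreal_mult intro!: ennreal_leI mult_right_mono)
    qed
    also have "\<dots> = ennreal K * (\<integral>\<^sup>+A. ennreal (x A) \<partial>count_space W)" by (rule nn_integral_cmult) simp
    also have "\<dots> \<le> ennreal K * ennreal D" by (intro mult_left_mono le) auto
    also have "\<dots> = ennreal (K * D powr (p / p))" using K D p by (simp flip: ennreal_mult)
    finally show "(\<integral>\<^sup>+A. ennreal ((\<Sum>\<^sub>\<infinity>Q\<in>shadow W Ch A. shadow_weight p Ch A Q) * x A powr (p / p)) \<partial>count_space W)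
        \<le> ennreal (K * D powr (p / p))" by (simp add: S_def)
  qed
qed

end

text \<open>Finiteness of the sums is expressed by summability, because \<open>infsum\<close> is 0
  for families that are not summable and a bound on its value would say nothing.\<close>

theorem theorem3p1:
  fixes G :: "(real^'n) set" and W :: "(real^'n) set set" and p q \<delta> \<tau> :: real
  assumes "CARD('n) \<ge> 2"
    and "open G" and "connected G" and "G \<noteq> {}" and "bounded G"
    and "whitney_decomposition G W"
    and "1 \<le> q" and "q \<le> p"
    and "0 < \<delta>" and "\<delta> < 1" and "0 < \<tau>" and "\<tau> < 1"
  shows
   "(q < p \<and>
     (\<exists>Q0 C. chain_decomposition W Q0 C \<and>
        (\<forall>A\<in>W. (\<lambda>Q. pow0 (real (chain_length (C Q))) (q - 1) * measure lebesgue Q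
                       * measure lebesgue A powr (q * (\<delta> / real CARD('n) - 1 / p)))
                  summable_on shadow W C A) \<and>
        (\<lambda>A. (\<Sum>\<^sub>\<infinity>Q\<in>shadow W C A. pow0 (real (chain_length (C Q))) (q - 1) * measure lebesgue Q
                       * measure lebesgue A powr (q * (\<delta> / real CARD('n) - 1 / p))) powr (p / (p - q)))
          summable_on W)
     \<longrightarrow> fractional_poincare G q p \<delta> \<tau>)
  \<and>
   (q = p \<and>
     (\<exists>Q0 C. chain_decomposition W Q0 C \<and>
        (\<forall>A\<in>W. (\<lambda>Q. pow0 (real (chain_length (C Q))) (p - 1) * measure lebesgue Q
                       * measure lebesgue A powr (p * \<delta> / real CARD('n) - 1))
                  summable_on shadow W C A) \<and>
        bdd_above ((\<lambda>A. \<Sum>\<^sub>\<infinity>Q\<in>shadow W C A. pow0 (real (chain_length (C Q))) (p - 1) * measure lebesgue Q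
                       * measure lebesgue A powr (p * \<delta> / real CARD('n) - 1)) ` W))
     \<longrightarrow> fractional_poincare G p p \<delta> \<tau>)"
proof (intro conjI impI; elim conjE exE)
  interpret whitney_frac G W p \<delta> \<tau>
    using assms by unfold_locales auto
  {
    fix Q0 C
    assume "q < p" "chain_decomposition W Q0 C"
      and "\<forall>A\<in>W. (\<lambda>Q. pow0 (real (chain_length (C Q))) (q - 1) * measure lebesgue Q
             * measure lebesgue A powr (q * (\<delta> / real CARD('n) - 1 / p))) summable_on shadow W C A"
      and "(\<lambda>A. (\<Sum>\<^sub>\<infinity>Q\<in>shadow W C A. pow0 (real (chain_length (C Q))) (q - 1) * measure lebesgue Q
             * measure lebesgue A powr (q * (\<delta> / real CARD('n) - 1 / p))) powr (p / (p - q))) summable_on W"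
    then show "fractional_poincare G q p \<delta> \<tau>"
      using poincare_subcritical[of Q0 C q] \<open>1 \<le> q\<close> by (simp add: shadow_weight_def[abs_def])
  }
  {
    fix Q0 C
    \<comment> \<open>At q = p the exponent of |A| in \<open>shadow_weight\<close> becomes the one
      in the second condition.\<close>
    have exponent: "p * (\<delta> / real CARD('n) - 1 / p) = p * \<delta> / real CARD('n) - 1"
      using p by (simp add: right_diff_distrib)
    assume "chain_decomposition W Q0 C"
      and "\<forall>A\<in>W. (\<lambda>Q. pow0 (real (chain_length (C Q))) (p - 1) * measure lebesgue Q
             * measure lebesgue A powr (p * \<delta> / real CARD('n) - 1)) summable_on shadow W C A"
      and "bdd_above ((\<lambda>A. \<Sum>\<^sub>\<infinity>Q\<in>shadow W C A. pow0 (real (chain_length (C Q))) (p - 1) * measure lebesgue Q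
             * measure lebesgue A powr (p * \<delta> / real CARD('n) - 1)) ` W)"
    then show "fractional_poincare G p p \<delta> \<tau>"
      using poincare_critical[of Q0 C] by (simp add: shadow_weight_def[abs_def] exponent)
  }
qed

end
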